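(* For any $(x_0,t_0)\in\mathbb{R}\times\mathbb{R}^+$, the entropy solution $u(x,t)$ on $\mathbb{R}\times(0,t_0)$ satisfies: (i) If $(x,t)\in\Delta_{\partial\mathcal{U}}(x_0,t_0)$, then $u(x-,t)=u(x+,t)$ and $u(x\pm,t)\in\partial\mathcal{U}(x_0,t_0)$. (ii) If there exists a component $I_m=(a_m,b_m)$ of the interior of $\mathcal{U}(x_0,t_0)$, then in $\Delta_{I_m}(x_0,t_0)$ $$u(x,t)=(f')^{-1}\Big(\frac{x-x_0}{t-t_0}\Big)\in I_m,$$ and the initial data satisfies $\varphi(x)=(f')^{-1}\big(\frac{x_0-x}{t_0}\big)$ for a.e. $x\in[x_0-t_0f'(b_m),\,x_0-t_0f'(a_m)]$. (iii) If there exists a component $J_n=(c_n,d_n)$ of $\mathcal{U}^c(x_0,t_0)$, then for any $(x_1,t_1)\in\Delta_{J_n}(x_0,t_0)$ the forward generalized characteristic $X(x_1,t_1):x=x(t)$, $t\ge t_1$, passes through $(x_0,t_0)$, and there exists $\underline t<t_0$ such that $u(x(t)+,t)<u(x(t)-,t)$ on $t\in(\underline t,t_0]$. Furthermore, if $X(x_i,t_i):x=x_i(t)$, $t\ge t_i$, are the forward generalized characteristics of two different points $(x_i,t_i)\in\Delta_{J_n}(x_0,t_0)$, $i=1,2$, then there exists $\bar t$ with $\max\{t_1,t_2\}<\bar t<t_0$ such that $x_1(t)=x_2(t)$ on $[\bar t,t_0]$. Moreover, the set of discontinuity points $\Gamma(\Delta_{J_n}(x_0,t_0))=\{(x,t)\in\Delta_{J_n}(x_0,t_0):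 u(x+,t)<u(x-,t)\}$ is path-connected. (iv) For any point $(x_1,t_1)\in\Delta_{(-\infty,u_0^+)}(x_0,t_0)\cup\Delta_{(u_0^-,\infty)}(x_0,t_0)$, where $u_0^\pm=u(x_0\pm,t_0)$, the forward generalized characteristic of $(x_1,t_1)$ does not pass through $(x_0,t_0)$.
   Context: Setting: $f\in C^2(\mathbb{R})$, $f''\ge0$, $\mathcal{L}\{f''=0\}=0$, so $f'$ is strictly increasing; $\varphi\in L^\infty(\mathbb{R})$. For $t>0$: $E(u;x,t)=t\int_0^u f''(s)(\varphi(x-tf'(s))-s)\,ds$; $\mathcal{U}(x,t)$ is the (nonempty compact) set of maximizers of $E(\cdot\,;x,t)$. The entropy solution of $u_t+f(u)_x=0$, $u|_{t=0}=\varphi$ is $u(x,t)=\inf\mathcal{U}(x,t)$, with traces $u(x-,t)=\sup\mathcal{U}(x,t)$, $u(x+,t)=\inf\mathcal{U}(x,t)$. For $(x_0,t_0)$ with $t_0>0$: $I=I(x_0,t_0)=[u(x_0+,t_0),u(x_0-,t_0)]\supset\mathcal{U}(x_0,t_0)$; $\partial\mathcal{U}(x_0,t_0)$ and $\mathring{\mathcal{U}}(x_0,t_0)=\bigcup_mI_m$ are the boundary and interior of $\mathcal{U}(x_0,t_0)$, and $\mathcal{U}^c(x_0,t_0)=I\setminus\mathcal{U}(x_0,t_0)=\bigcup_nJ_n$, where $I_m=(a_m,b_m)$ and $J_n=(c_n,d_n)$ are the (at most countably many, disjoint) component open intervals. $l_u(x_0,t_0)=\{(x,t): x=x_0+(t-t_0)f'(u),\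 t\in(0,t_0)\}$, and for $G\subset\mathbb{R}$, $\Delta_G(x_0,t_0)=\bigcup_{u\in G}l_u(x_0,t_0)$; $\Delta_{\partial\mathcal U}$ means $G=\partial\mathcal{U}(x_0,t_0)$. $\Delta_I(x_0,t_0)$ is the backward characteristic triangle. Forward generalized characteristic $X(x_0,t_0)$: the unique curve $x=x(t)$, $t_0\le t<\infty$, $x(t_0)=x_0$, such that $\Delta_I(x_0,t_0)\subset\Delta_I(x(t_1),t_1)\subset\Delta_I(x(t_2),t_2)$ for all $t_2>t_1>t_0$ (it exists, is unique, and is continuous). *)

theory Defs
  imports "HOL-Analysis.Analysis"
begin

text \<open>
  Throughout, \<open>f\<close> is the flux and \<open>\<phi>\<close> the initial datum of \<open>u\<^sub>t + f(u)\<^sub>x = 0\<close>; the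
  derivatives \<open>f'\<close> and \<open>f''\<close> are \<open>deriv f\<close> and \<open>deriv (deriv f)\<close>. Points of the
  half plane are pairs \<open>(x, t)\<close>.
\<close>

definition C2 :: "(real \<Rightarrow> real) \<Rightarrow> bool" where
  "C2 f \<longleftrightarrow> f differentiable_on UNIV \<and> deriv f differentiable_on UNIV
     \<and> continuous_on UNIV (deriv (deriv f))"

definition L_infinity :: "(real \<Rightarrow> real) \<Rightarrow> bool" where
  "L_infinity \<phi> \<longleftrightarrow> \<phi> \<in> borel_measurable lebesgue \<and> (\<exists>C. AE x in lebesgue. \<bar>\<phi> x\<bar> \<le> C)"

text \<open>
  The integral is oriented (\<open>u\<close> may be negative). It is taken over \<open>lebesgue\<close>, not
  \<open>lborel\<close>, because \<open>\<phi>\<close> is only Lebesgue measurable.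
\<close>

definition energy :: "(real \<Rightarrow> real) \<Rightarrow> (real \<Rightarrow> real) \<Rightarrow> real \<Rightarrow> real \<Rightarrow> real \<Rightarrow> real" where
  "energy f \<phi> u x t =
     t * (LINT s=ereal 0..ereal u|lebesgue. (deriv (deriv f) s * (\<phi> (x - t * deriv f s) - s)))"

definition maximizers :: "(real \<Rightarrow> real) \<Rightarrow> (real \<Rightarrow> real) \<Rightarrow> real \<Rightarrow> real \<Rightarrow> real set" where
  "maximizers f \<phi> x t = {u. \<forall>v. energy f \<phi> v x t \<le> energy f \<phi> u x t}"

definition entropy_sol :: "(real \<Rightarrow> real) \<Rightarrow> (real \<Rightarrow> real) \<Rightarrow> real \<Rightarrow> real \<Rightarrow> real" where
  "entropy_sol f \<phi> x t = Inf (maximizers f \<phi> x t)"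

text \<open>
  The traces \<open>u(x-,t)\<close> and \<open>u(x+,t)\<close> are the one-sided limits in \<open>x\<close>. For \<open>t > 0\<close> these
  exist and are the supremum and the infimum of \<open>maximizers f \<phi> x t\<close>.
\<close>

definition trace_left :: "(real \<Rightarrow> real) \<Rightarrow> (real \<Rightarrow> real) \<Rightarrow> real \<Rightarrow> real \<Rightarrow> real" where
  "trace_left f \<phi> x t = Lim (at_left x) (\<lambda>y. entropy_sol f \<phi> y t)"

definition trace_right :: "(real \<Rightarrow> real) \<Rightarrow> (real \<Rightarrow> real) \<Rightarrow> real \<Rightarrow> real \<Rightarrow> real" where
  "trace_right f \<phi> x t = Lim (at_right x) (\<lambda>y. entropy_sol f \<phi> y t)"

definition state_interval :: "(real \<Rightarrow> real) \<Rightarrow> (real \<Rightarrow> real) \<Rightarrow> real \<Rightarrow> real \<Rightarrow> real set" where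
  "state_interval f \<phi> x t = {trace_right f \<phi> x t .. trace_left f \<phi> x t}"

definition char_line :: "(real \<Rightarrow> real) \<Rightarrow> real \<Rightarrow> real \<Rightarrow> real \<Rightarrow> (real \<times> real) set" where
  "char_line f x\<^sub>0 t\<^sub>0 u = {(x, t). x = x\<^sub>0 + (t - t\<^sub>0) * deriv f u \<and> t \<in> {0<..<t\<^sub>0}}"

definition Delta :: "(real \<Rightarrow> real) \<Rightarrow> real \<Rightarrow> real \<Rightarrow> real set \<Rightarrow> (real \<times> real) set" where
  "Delta f x\<^sub>0 t\<^sub>0 G = (\<Union>u\<in>G. char_line f x\<^sub>0 t\<^sub>0 u)"

definition char_triangle ::
    "(real \<Rightarrow> real) \<Rightarrow> (real \<Rightarrow> real) \<Rightarrow> real \<Rightarrow> real \<Rightarrow> (real \<times> real) set" where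
  "char_triangle f \<phi> x\<^sub>0 t\<^sub>0 = Delta f x\<^sub>0 t\<^sub>0 (state_interval f \<phi> x\<^sub>0 t\<^sub>0)"

definition is_forward_char ::
    "(real \<Rightarrow> real) \<Rightarrow> (real \<Rightarrow> real) \<Rightarrow> real \<Rightarrow> real \<Rightarrow> (real \<Rightarrow> real) \<Rightarrow> bool" where
  "is_forward_char f \<phi> x\<^sub>0 t\<^sub>0 X \<longleftrightarrow> X t\<^sub>0 = x\<^sub>0 \<and>
     (\<forall>t\<^sub>1 t\<^sub>2. t\<^sub>0 < t\<^sub>1 \<and> t\<^sub>1 < t\<^sub>2 \<longrightarrow>
        char_triangle f \<phi> x\<^sub>0 t\<^sub>0 \<subseteq> char_triangle f \<phi> (X t\<^sub>1) t\<^sub>1 \<and>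
        char_triangle f \<phi> (X t\<^sub>1) t\<^sub>1 \<subseteq> char_triangle f \<phi> (X t\<^sub>2) t\<^sub>2)"

text \<open>
  A curve is only defined on \<open>{t\<^sub>0..}\<close>, hence \<open>extensional\<close>, which makes the description
  unique as a total function.
\<close>

definition forward_char ::
    "(real \<Rightarrow> real) \<Rightarrow> (real \<Rightarrow> real) \<Rightarrow> real \<Rightarrow> real \<Rightarrow> real \<Rightarrow> real" where
  "forward_char f \<phi> x\<^sub>0 t\<^sub>0 =
     (THE X. X \<in> extensional {t\<^sub>0..} \<and> is_forward_char f \<phi> x\<^sub>0 t\<^sub>0 X)"

definition discontinuities ::
    "(real \<Rightarrow> real) \<Rightarrow> (real \<Rightarrow> real) \<Rightarrow> (real \<times> real) set \<Rightarrow> (real \<times> real) set" where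
  "discontinuities f \<phi> D = {(x, t) \<in> D. trace_right f \<phi> x t < trace_left f \<phi> x t}"

end

theory Submission
  imports Defs
begin

text \<open>
  Substituting \<open>y = x - t f' s\<close> turns the energy into a constant minus the Lax--Hopf functional
  \<open>\<Phi> (x - t f' u) + t G u\<close>, where \<open>\<Phi>\<close> is the (Lipschitz) primitive of \<open>\<phi>\<close> and \<open>G\<close> is strictly
  convex as a function of the speed \<open>f' u\<close>. Hence below a point \<open>(x, t)\<close> every maximizer \<open>u\<close> is the
  only maximizer along its own characteristic, so that maximizing characteristics never cross. Thus
  at an earlier time the bases of the triangles of the points \<open>(x, t)\<close>, \<open>t\<close> fixed, are ordered and
  cover the line, and the forward characteristic is the unique curve whose triangles contain its
  starting point.

  A forward characteristic issued in a gap of the maximizers at \<open>(x\<^sub>0, t\<^sub>0)\<close> is confined to the gap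
  region. By compactness, no maximizing characteristic from a point of the region close enough
  to \<open>(x\<^sub>0, t\<^sub>0)\<close> passes between two given points of the region at an earlier time, since its limit
  would be a maximizer inside the gap. This forces both the jump and the merging of the forward
  characteristics. Where the maximizers fill an interval, \<open>\<Phi>\<close> is an explicit Legendre transform,
  and \<open>\<phi>\<close> is recovered by differentiation.
\<close>

text \<open>By maximality of a component: an endpoint outside \<open>S\<close> could be adjoined to
  the interval, which would stay connected and inside \<open>{a..b} - S\<close>. For the maximizer
  set this makes both edges of a gap maximizers.\<close>

lemma component_Ioo_endpoints:
  fixes a b c d :: real
  assumes "{c<..<d} \<in> components ({a..b} - S)" "a \<in> S" "b \<in> S"
  shows "c \<in> S" "d \<in> S" "{c<..<d} \<inter> S = {}"
proof -
  have sub: "{c<..<d} \<subseteq> {a..b} - S" and ne: "{c<..<d} \<noteq> {}"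
    using assms(1) in_components_subset in_components_nonempty by blast+
  then have cd: "c < d" by simp
  show "{c<..<d} \<inter> S = {}" using sub by blast
  have "{c<..<d} \<subseteq> {a..b}" using sub by blast
  then have "closure {c<..<d} \<subseteq> {a..b}" by (rule closure_minimal) simp
  then have bounds: "a \<le> c" "d \<le> b" using cd by auto
  have max: "X \<subseteq> {c<..<d}" if "connected X" "X \<subseteq> {a..b} - S" "{c<..<d} \<subseteq> X" for X
    using components_maximal[OF assms(1) that(1,2)] that(3) ne by blast
  show "c \<in> S"
  proof (rule ccontr)
    assume "c \<notin> S"
    then have "{c..<d} \<subseteq> {a..b} - S" using sub cd bounds
      by (auto simp: subset_iff order_le_less)
    then have "{c..<d} \<subseteq> {c<..<d}" by (intro max) auto
    then show False using cd by auto
  qed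
  show "d \<in> S"
  proof (rule ccontr)
    assume "d \<notin> S"
    then have "{c<..d} \<subseteq> {a..b} - S" using sub cd bounds
      by (auto simp: subset_iff order_le_less)
    then have "{c<..d} \<subseteq> {c<..<d}" by (intro max) auto
    then show False using cd by auto
  qed
qed

section \<open>The Lax--Hopf functional\<close>

locale convex_cauchy_problem =
  fixes f \<phi> :: "real \<Rightarrow> real" and C :: real
  assumes C2: "C2 f"
    and convex: "\<And>s. deriv (deriv f) s \<ge> 0"
    and degenerate_null: "{s. deriv (deriv f) s = 0} \<in> null_sets lebesgue"
    and measurable: "\<phi> \<in> borel_measurable lebesgue"
    and bounded: "AE x in lebesgue. \<bar>\<phi> x\<bar> \<le> C"
begin

abbreviation p :: "real \<Rightarrow> real" where "p \<equiv> deriv f"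
abbreviation U :: "real \<Rightarrow> real \<Rightarrow> real set" where "U \<equiv> maximizers f \<phi>"

lemma deriv_flux: "(f has_real_derivative p s) (at s)"
  using C2 unfolding C2_def
  by (metis DERIV_deriv_iff_real_differentiable UNIV_I differentiable_on_def)

lemma deriv_speed: "(p has_real_derivative deriv p s) (at s)"
  using C2 unfolding C2_def
  by (metis DERIV_deriv_iff_real_differentiable UNIV_I differentiable_on_def)

lemma continuous_p: "continuous_on UNIV p"
  using deriv_speed DERIV_continuous_on by blast

text \<open>A nonnegative derivative makes \<open>p\<close> monotone. If it took the same value at
  two points it would be constant between them, and its derivative would vanish on a set of positive
  measure.\<close>

lemma strict_mono_p: "strict_mono p"
proof -
  have mono: "p u \<le> p v" if "u \<le> v" for u v
    using DERIV_nonneg_imp_nondecreasing[OF that] deriv_speed convex by blast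
  show ?thesis
  proof (rule strict_monoI, rule ccontr)
    fix u v :: real assume "u < v" and "\<not> p u < p v"
    with mono[of u v] have eq: "p u = p v" by simp
    have "deriv p s = 0" if "s \<in> {u<..<v}" for s
    proof -
      have const: "p r = p u" if "r \<in> {u<..<v}" for r
        using mono[of u r] mono[of r v] eq that by auto
      have "((\<lambda>_. p u) has_real_derivative deriv p s) (at s)"
        by (rule has_field_derivative_transform_within_open[OF deriv_speed, where S = "{u<..<v}"])
          (use that const in auto)
      then show ?thesis
        using DERIV_unique DERIV_const by blast
    qed
    then have "{u<..<v} \<subseteq> {s. deriv p s = 0}" by auto
    then have "negligible {u<..<v}"
      using degenerate_null negligible_iff_null_sets negligible_subset by blast
    then show False
      using \<open>u < v\<close> negligible_interval(2)[of u v] by (simp add: box_real)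
  qed
qed

lemma p_less_iff [simp]: "p u < p v \<longleftrightarrow> u < v"
  and p_le_iff [simp]: "p u \<le> p v \<longleftrightarrow> u \<le> v"
  and p_eq_iff [simp]: "p u = p v \<longleftrightarrow> u = v"
  using strict_mono_p by (auto simp: strict_mono_less strict_mono_less_eq strict_mono_eq)

lemma p_intermediate:
  assumes "p a \<le> q" "q \<le> p b"
  obtains w where "p w = q" "a \<le> w" "w \<le> b"
proof -
  have "a \<le> b" using assms by (meson order_trans p_le_iff)
  then show ?thesis
    using IVT'[of p a q b] assms continuous_on_subset[OF continuous_p subset_UNIV] that by blast
qed

text \<open>Up to the constant \<open>f 0\<close> this is the Legendre transform of \<open>f\<close> evaluated at \<open>p u\<close>.\<close>

definition G :: "real \<Rightarrow> real" where "G u = u * p u - f u"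

lemma continuous_G: "continuous_on UNIV G"
  unfolding G_def
  by (intro continuous_intros continuous_p DERIV_continuous_on[OF DERIV_subset[OF deriv_flux]]) auto

text \<open>The difference quotient of \<open>f\<close> is some \<open>p z\<close> with
  \<open>u < z < v\<close>, hence strictly between \<open>p u\<close> and \<open>p v\<close>.
  Regarded as a function of the speed, \<open>G\<close> thus has strict supporting lines of slope
  \<open>u\<close> at \<open>p u\<close> and of slope \<open>v\<close> at
  \<open>p v\<close>.\<close>

lemma G_bounds:
  assumes "u < v"
  shows "u * (p v - p u) < G v - G u" "G v - G u < v * (p v - p u)"
proof -
  obtain z where z: "u < z" "z < v" "f v - f u = (v - u) * p z"
    using MVT2[OF assms, of f p] deriv_flux by blast
  have "(v - u) * p u < (v - u) * p z" "(v - u) * p z < (v - u) * p v"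
    using z assms by (simp_all add: mult_less_cancel_left)
  with z(3) show "u * (p v - p u) < G v - G u" "G v - G u < v * (p v - p u)"
    by (auto simp: G_def algebra_simps)
qed

text \<open>\<open>G_bounds\<close> on both sides of \<open>w\<close>, weighted by
  \<open>1 - \<theta>\<close> and \<open>\<theta>\<close>: the terms with slope \<open>w\<close>
  cancel because \<open>p w\<close> is the convex combination of the two speeds. Exchanging
  \<open>u\<close> and \<open>v\<close> replaces \<open>\<theta>\<close> by
  \<open>1 - \<theta>\<close>.\<close>

lemma G_strictly_convex:
  assumes "u \<noteq> v" "0 < \<theta>" "\<theta> < 1" "p w = (1 - \<theta>) * p u + \<theta> * p v"
  shows "G w < (1 - \<theta>) * G u + \<theta> * G v"
proof -
  have *: "G w < (1 - \<theta>) * G u + \<theta> * G v"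
    if "u < v" "0 < \<theta>" "\<theta> < 1" "p w = (1 - \<theta>) * p u + \<theta> * p v" for u v \<theta>
  proof -
    have 1: "p w - p u = \<theta> * (p v - p u)" "p v - p w = (1 - \<theta>) * (p v - p u)"
      using that(4) by (auto simp: algebra_simps)
    then have "0 < p w - p u" "0 < p v - p w" using that by auto
    then have "u < w" "w < v" by auto
    then have "(1 - \<theta>) * (G w - G u) < (1 - \<theta>) * (w * (p w - p u))"
      "\<theta> * (w * (p v - p w)) < \<theta> * (G v - G w)"
      using G_bounds[of u w] G_bounds[of w v] that(2,3) by (intro mult_strict_left_mono; simp)+
    moreover have "(1 - \<theta>) * (w * (p w - p u)) = \<theta> * (w * (p v - p w))"
      unfolding 1 by simp
    ultimately show ?thesis by (simp add: algebra_simps)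
  qed
  show ?thesis
  proof (cases "u < v")
    case True
    then show ?thesis using * assms by blast
  next
    case False
    then show ?thesis using *[of v u "1 - \<theta>"] assms by (simp add: algebra_simps)
  qed
qed

section \<open>The datum and its Lipschitz primitive\<close>

lemma exceptional_set:
  obtains N where "negligible N" "\<And>x. x \<notin> N \<Longrightarrow> \<bar>\<phi> x\<bar> \<le> C"
  using bounded unfolding eventually_ae_filter by (auto simp: negligible_iff_null_sets)

lemma absolutely_integrable_datum: "\<phi> absolutely_integrable_on {a..b}"
proof -
  \<comment> \<open>Cutting \<open>\<phi>\<close> off where the essential bound fails changes it on
    a null set only and leaves a function bounded everywhere.\<close>
  define g where "g x = (if \<bar>\<phi> x\<bar> \<le> C then \<phi> x else 0)" for x
  obtain N where N: "negligible N" "\<And>x. x \<notin> N \<Longrightarrow> \<bar>\<phi> x\<bar> \<le> C"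
    by (metis exceptional_set)
  have "g \<in> borel_measurable lebesgue"
    unfolding g_def using measurable by measurable
  then have "g \<in> borel_measurable (lebesgue_on {a..b})"
    by (simp add: measurable_restrict_space1)
  then have "g absolutely_integrable_on {a..b}"
    by (rule measurable_bounded_by_integrable_imp_absolutely_integrable[where g = "\<lambda>_. \<bar>C\<bar>"])
       (auto simp: g_def)
  then show ?thesis
    by (rule absolutely_integrable_spike[where S = N])
       (use N in \<open>auto simp: g_def\<close>)
qed

lemma integrable_datum: "\<phi> integrable_on {a..b}"
  using absolutely_integrable_datum set_lebesgue_integral_eq_integral(1) by blast

definition primitive :: "real \<Rightarrow> real" where
  "primitive y = (if 0 \<le> y then integral {0..y} \<phi> else - integral {y..0} \<phi>)"

lemma primitive_diff:
  assumes "a \<le> b"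
  shows "integral {a..b} \<phi> = primitive b - primitive a"
  using Henstock_Kurzweil_Integration.integral_combine[OF _ _ integrable_datum, of a 0 b]
    Henstock_Kurzweil_Integration.integral_combine[OF _ _ integrable_datum, of 0 a b]
    Henstock_Kurzweil_Integration.integral_combine[OF _ _ integrable_datum, of a b 0] assms
  by (auto simp: primitive_def)

lemma primitive_lipschitz: "\<bar>primitive a - primitive b\<bar> \<le> C * \<bar>a - b\<bar>"
proof -
  obtain N where N: "negligible N" "\<And>x. x \<notin> N \<Longrightarrow> \<bar>\<phi> x\<bar> \<le> C"
    by (metis exceptional_set)
  have "C \<ge> 0"
  proof (rule ccontr)
    assume "\<not> 0 \<le> C"
    then have "N = UNIV" using N(2) by (force intro: order_trans[OF abs_ge_zero])
    with N(1) show False by simp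
  qed
  define g where "g x = (if \<bar>\<phi> x\<bar> \<le> C then \<phi> x else 0)" for x
  have *: "\<bar>primitive b - primitive a\<bar> \<le> C * (b - a)" if "a \<le> b" for a b
  proof -
    have "(\<phi> has_integral (primitive b - primitive a)) {a..b}"
      using integrable_datum primitive_diff[OF that] by (simp add: has_integral_iff)
    then have "(g has_integral (primitive b - primitive a)) {a..b}"
      by (rule has_integral_spike[where S = N, rotated 2])
         (use N in \<open>auto simp: g_def\<close>)
    then show ?thesis
      using has_integral_bound[of C g _ a b] \<open>C \<ge> 0\<close> that by (auto simp: g_def)
  qed
  show ?thesis
    using *[of a b] *[of b a] by (cases "a \<le> b") (auto simp: abs_minus_commute)
qed

lemma C_nonneg: "C \<ge> 0"
  using primitive_lipschitz[of 0 1] by (auto intro: order_trans[OF abs_ge_zero])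

lemma continuous_primitive: "continuous_on UNIV primitive"
proof -
  have "C-lipschitz_on UNIV primitive"
    using C_nonneg primitive_lipschitz by (intro lipschitz_onI) (auto simp: dist_real_def)
  then show ?thesis by (rule lipschitz_on_continuous_on)
qed

text \<open>The functional of the Lax--Hopf formula.\<close>

definition cost :: "real \<Rightarrow> real \<Rightarrow> real \<Rightarrow> real" where
  "cost u x t = primitive (x - t * p u) + t * G u"

text \<open>The substitution \<open>y = x - t * p s\<close>, with Jacobian
  \<open>t * deriv p s\<close>, turns the part with \<open>\<phi>\<close> into a difference of
  values of \<open>primitive\<close>. The remaining part is exact, since \<open>G\<close> has
  derivative \<open>s * deriv p s\<close>.\<close>

lemma integral_energy_density:
  assumes "a \<le> b" "t > 0"
  shows "t * (LINT s:{a<..<b}|lebesgue. (deriv p s * (\<phi> (x - t * p s) - s))) = cost a x t - cost b x t"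
proof -
  let ?g = "\<lambda>s. x - t * p s"
  have image: "?g ` {a..b} = {x - t * p b..x - t * p a}"
  proof (intro subset_antisym subsetI)
    fix y assume y: "y \<in> {x - t * p b..x - t * p a}"
    then have "p a \<le> (x - y) / t" "(x - y) / t \<le> p b"
      using assms(2) by (auto simp: field_simps)
    then obtain w where "p w = (x - y) / t" "a \<le> w" "w \<le> b"
      by (rule p_intermediate)
    then show "y \<in> ?g ` {a..b}"
      using assms(2) by (intro image_eqI[of _ _ w]) auto
  qed (use assms in auto)
  have der: "(?g has_real_derivative - (t * deriv p s)) (at s within {a..b})" for s
    by (auto intro!: derivative_eq_intros DERIV_subset[OF deriv_speed])
  have inj: "inj_on ?g {a..b}"
    using assms(2) by (auto simp: inj_on_def)
  have abs: "\<bar>- (t * deriv p s)\<bar> = t * deriv p s" for s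
    using convex assms(2) by (simp add: abs_mult)
  have "(\<lambda>s. t * deriv p s * \<phi> (?g s)) absolutely_integrable_on {a..b} \<and>
    integral {a..b} (\<lambda>s. t * deriv p s * \<phi> (?g s)) = primitive (x - t * p a) - primitive (x - t * p b)"
    using has_absolute_integral_change_of_variables_1'[OF _ der inj, of \<phi>]
      absolutely_integrable_datum primitive_diff assms
    unfolding image abs by (simp add: mult_left_mono)
  then have 1: "(\<lambda>s. t * deriv p s * \<phi> (?g s)) absolutely_integrable_on {a..b}"
    and 2: "((\<lambda>s. t * deriv p s * \<phi> (?g s)) has_integral
      (primitive (x - t * p a) - primitive (x - t * p b))) {a..b}"
    by (auto simp: has_integral_iff set_lebesgue_integral_eq_integral(1))
  have dG: "(G has_real_derivative s * deriv p s) (at s within {a..b})" for s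
    unfolding G_def
    by (auto intro!: derivative_eq_intros DERIV_subset[OF deriv_speed] DERIV_subset[OF deriv_flux])
  have 3: "((\<lambda>s. s * deriv p s) has_integral (G b - G a)) {a..b}"
    by (intro fundamental_theorem_of_calculus assms)
      (use dG has_real_derivative_iff_has_vector_derivative in blast)
  have 4: "(\<lambda>s. t * (s * deriv p s)) absolutely_integrable_on {a..b}"
    using C2 unfolding C2_def
    by (intro absolutely_integrable_continuous_real continuous_intros) (auto intro: continuous_on_subset)
  let ?h = "\<lambda>s. t * (deriv p s * (\<phi> (?g s) - s))"
  have h: "?h = (\<lambda>s. t * deriv p s * \<phi> (?g s) - t * (s * deriv p s))"
    by (auto simp: algebra_simps)
  have "?h absolutely_integrable_on {a..b}"
    unfolding h by (rule set_integral_diff(1)[OF 1 4])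
  then have 5: "?h absolutely_integrable_on {a<..<b}"
    by (rule set_integrable_subset) auto
  have "(?h has_integral (primitive (x - t * p a) - primitive (x - t * p b)) - t * (G b - G a)) {a..b}"
    unfolding h by (intro has_integral_diff 2 has_integral_mult_right 3)
  then have "integral {a<..<b} ?h = cost a x t - cost b x t"
    by (simp add: integral_unique algebra_simps cost_def flip: integral_open_interval_real)
  then show ?thesis
    using set_lebesgue_integral_eq_integral(2)[OF 5] by simp
qed

text \<open>The term \<open>cost 0 x t\<close> does not depend on \<open>u\<close>, so maximizing
  the energy means minimizing \<open>cost\<close>. For negative \<open>u\<close> the orientation of
  the integral supplies the sign.\<close>

lemma energy_eq_cost:
  assumes "t > 0"
  shows "energy f \<phi> u x t = cost 0 x t - cost u x t"
  unfolding energy_def interval_lebesgue_integral_def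
  using integral_energy_density[OF _ assms, of 0 u x] integral_energy_density[OF _ assms, of u 0 x]
  by (auto simp: not_le)

lemma maximizers_iff:
  assumes "t > 0"
  shows "u \<in> U x t \<longleftrightarrow> (\<forall>v. cost u x t \<le> cost v x t)"
  by (simp add: maximizers_def energy_eq_cost[OF assms])

section \<open>Maximizers and their characteristics\<close>

lemma p_convex_combination:
  assumes "0 \<le> \<theta>" "\<theta> \<le> 1"
  obtains w where "p w = (1 - \<theta>) * p u + \<theta> * p v"
proof -
  have "p (min u v) \<le> (1 - \<theta>) * p u + \<theta> * p v"
    using convex_bound_le[of "- p u" "- p (min u v)" "- p v" "1 - \<theta>" \<theta>] assms by simp
  moreover have "(1 - \<theta>) * p u + \<theta> * p v \<le> p (max u v)"
    using convex_bound_le[of "p u" "p (max u v)" "p v" "1 - \<theta>" \<theta>] assms by simp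
  ultimately show ?thesis using that p_intermediate by metis
qed

text \<open>As functions of the speed, \<open>primitive\<close> can gain at most the rate
  \<open>t * C\<close>, while by \<open>G_bounds\<close> the term \<open>t * G u\<close> loses more
  than that beyond \<open>C\<close> or below \<open>- C\<close>.\<close>

lemma cost_outside:
  assumes "t > 0"
  shows "C < u \<Longrightarrow> cost C x t < cost u x t" "u < - C \<Longrightarrow> cost (- C) x t < cost u x t"
proof -
  have lip: "\<bar>primitive (x - t * p v) - primitive (x - t * p w)\<bar> \<le> t * (C * \<bar>p v - p w\<bar>)" for v w
    using primitive_lipschitz[of "x - t * p v" "x - t * p w"] assms
    by (simp add: abs_mult abs_minus_commute mult.left_commute flip: right_diff_distrib)
  show "cost C x t < cost u x t" if "C < u"
    using lip[of u C] G_bounds(1)[OF that] that assms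
      mult_strict_left_mono[OF G_bounds(1)[OF that] assms]
    by (simp add: cost_def right_diff_distrib)
  show "cost (- C) x t < cost u x t" if "u < - C"
    using lip[of u "- C"] that assms
      mult_strict_left_mono[OF G_bounds(2)[OF that] assms]
    by (simp add: cost_def right_diff_distrib)
qed

lemma maximizers_bounded:
  assumes "t > 0" "u \<in> U x t"
  shows "\<bar>u\<bar> \<le> C"
proof (rule ccontr)
  assume "\<not> ?thesis"
  then have "C < u \<or> u < - C" by auto
  then show False
    using cost_outside[OF assms(1), of u x] assms by (auto simp: maximizers_iff not_less[symmetric])
qed

lemma tendsto_cost:
  assumes "(u \<longlongrightarrow> a) F" "(x \<longlongrightarrow> b) F" "(t \<longlongrightarrow> c) F"
  shows "((\<lambda>n. cost (u n) (x n) (t n)) \<longlongrightarrow> cost a b c) F"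
proof -
  have "isCont p z" "isCont G z" "isCont primitive z" for z
    using continuous_p continuous_G continuous_primitive by (auto simp: continuous_on_eq_continuous_at)
  then show ?thesis
    unfolding cost_def
    by (intro tendsto_intros isCont_tendsto_compose[of _ primitive] isCont_tendsto_compose[of _ p]
        isCont_tendsto_compose[of _ G] assms)
qed

lemma maximizers_nonempty:
  assumes "t > 0"
  shows "U x t \<noteq> {}"
proof -
  have "continuous_on {-C..C} (\<lambda>u. cost u x t)"
    unfolding continuous_on by (intro ballI tendsto_cost tendsto_intros)
  then obtain w where w: "w \<in> {-C..C}" "\<And>v. v \<in> {-C..C} \<Longrightarrow> cost w x t \<le> cost v x t"
    using continuous_attains_inf[of "{-C..C}" "\<lambda>u. cost u x t"] C_nonneg by auto
  \<comment> \<open>A minimum over \<open>{-C..C}\<close> is global, since any state outside is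
    beaten by the nearer of \<open>C\<close> and \<open>- C\<close>.\<close>
  have "cost w x t \<le> cost v x t" for v
    using w(2)[of v] w(2)[of C] w(2)[of "-C"] cost_outside[OF assms, of v x] C_nonneg
    by (cases "v \<in> {-C..C}") auto
  then show ?thesis using maximizers_iff[OF assms] by blast
qed

text \<open>Maximizers lie in the compact interval \<open>{-C..C}\<close>, and minimality of
  \<open>cost\<close> passes to the limit by joint continuity. All compactness arguments below rest
  on this.\<close>

lemma maximizers_subsequence:
  assumes "\<And>n. u n \<in> U (x n) (\<tau> n)" "\<And>n. \<tau> n > 0" "x \<longlonglongrightarrow> a" "\<tau> \<longlonglongrightarrow> b" "b > 0"
  obtains l r where "l \<in> U a b" "strict_mono r" "(u \<circ> r) \<longlonglongrightarrow> l"
proof -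
  have "compact {-C..C}" by simp
  moreover have "u n \<in> {-C..C}" for n
    using maximizers_bounded[OF assms(2,1)] by (simp add: abs_le_iff minus_le_iff)
  ultimately obtain l r where r: "strict_mono r" "(u \<circ> r) \<longlonglongrightarrow> l"
    unfolding compact_def by metis
  have lim: "(x \<circ> r) \<longlonglongrightarrow> a" "(\<tau> \<circ> r) \<longlonglongrightarrow> b"
    using assms(3,4) LIMSEQ_subseq_LIMSEQ r(1) by blast+
  have "cost l a b \<le> cost v a b" for v
  proof (rule LIMSEQ_le)
    show "(\<lambda>n. cost ((u \<circ> r) n) ((x \<circ> r) n) ((\<tau> \<circ> r) n)) \<longlonglongrightarrow> cost l a b"
      by (intro tendsto_cost r lim)
    show "(\<lambda>n. cost v ((x \<circ> r) n) ((\<tau> \<circ> r) n)) \<longlonglongrightarrow> cost v a b"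
      by (intro tendsto_cost tendsto_const lim)
    show "\<exists>N. \<forall>n\<ge>N. cost ((u \<circ> r) n) ((x \<circ> r) n) ((\<tau> \<circ> r) n) \<le> cost v ((x \<circ> r) n) ((\<tau> \<circ> r) n)"
      using assms(1,2) by (auto simp: maximizers_iff)
  qed
  then have "l \<in> U a b" using maximizers_iff[OF assms(5)] by blast
  then show ?thesis using that r by blast
qed

lemma compact_maximizers:
  assumes "t > 0"
  shows "compact (U x t)"
  unfolding compact_def
proof (intro allI impI)
  fix u :: "nat \<Rightarrow> real" assume "\<forall>n. u n \<in> U x t"
  then show "\<exists>l\<in>U x t. \<exists>r. strict_mono r \<and> (u \<circ> r) \<longlonglongrightarrow> l"
    using maximizers_subsequence[of u "\<lambda>_. x" "\<lambda>_. t" x t] assms by (metis tendsto_const)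
qed

abbreviation umin :: "real \<Rightarrow> real \<Rightarrow> real" where "umin x t \<equiv> Inf (U x t)"
abbreviation umax :: "real \<Rightarrow> real \<Rightarrow> real" where "umax x t \<equiv> Sup (U x t)"

lemma umin_in: "t > 0 \<Longrightarrow> umin x t \<in> U x t"
  and umax_in: "t > 0 \<Longrightarrow> umax x t \<in> U x t"
  and umin_le: "t > 0 \<Longrightarrow> u \<in> U x t \<Longrightarrow> umin x t \<le> u"
  and umax_ge: "t > 0 \<Longrightarrow> u \<in> U x t \<Longrightarrow> u \<le> umax x t"
  using compact_maximizers maximizers_nonempty
  by (auto intro!: closed_contains_Inf closed_contains_Sup cInf_lower cSup_upper compact_imp_closed
      bounded_imp_bdd_below bounded_imp_bdd_above compact_imp_bounded)

lemma umin_le_umax: "t > 0 \<Longrightarrow> umin x t \<le> umax x t"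
  using umin_le umax_in by blast

text \<open>
  If \<open>v \<noteq> u\<close> did as well at the intermediate point, then the straight line from its foot to \<open>(x, t)\<close>,
  whose slope is an average of \<open>p u\<close> and \<open>p v\<close>, would by strict convexity beat \<open>u\<close> at \<open>(x, t)\<close>.
\<close>

lemma maximizers_on_characteristic:
  assumes "u \<in> U x t" "0 < s" "s < t"
  shows "U (x - (t - s) * p u) s = {u}"
proof -
  let ?y = "x - (t - s) * p u"
  have t: "t > 0" using assms by simp
  have "cost u ?y s < cost v ?y s" if "v \<noteq> u" for v
  proof -
    \<comment> \<open>With this weight the line of speed \<open>p w\<close> through
      \<open>(x, t)\<close> has the same foot at time \<open>0\<close> as the line of speed
      \<open>p v\<close> through \<open>(?y, s)\<close>.\<close>
    define \<theta> where "\<theta> = s / t"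
    have \<theta>: "0 < \<theta>" "\<theta> < 1" "t * \<theta> = s" using assms by (auto simp: \<theta>_def)
    obtain w where w: "p w = (1 - \<theta>) * p u + \<theta> * p v"
      using p_convex_combination[of \<theta> u v] \<theta> by auto
    have "t * G w < t * ((1 - \<theta>) * G u + \<theta> * G v)"
      using G_strictly_convex[OF that[symmetric] \<theta>(1,2) w] t by simp
    also have "\<dots> = t * G u - t * \<theta> * G u + t * \<theta> * G v" by (simp add: algebra_simps)
    finally have 1: "t * G w < t * G u - s * G u + s * G v" unfolding \<theta>(3) .
    have "t * p w = t * p u - t * \<theta> * p u + t * \<theta> * p v" unfolding w by (simp add: algebra_simps)
    then have foot: "x - t * p w = ?y - s * p v" unfolding \<theta>(3) by (simp add: algebra_simps)
    have foot': "x - t * p u = ?y - s * p u" by (simp add: algebra_simps)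
    have "cost u x t \<le> cost w x t" using assms(1) maximizers_iff[OF t] by blast
    with 1 show ?thesis unfolding cost_def foot foot' by linarith
  qed
  then have "v = u" if "v \<in> U ?y s" for v
    using that maximizers_iff[OF assms(2)] by (meson not_less)
  then have "U ?y s \<subseteq> {u}" by blast
  then show ?thesis using maximizers_nonempty[OF assms(2)] by blast
qed

text \<open>Where two such lines meet, at a positive time, each of \<open>u\<close> and
  \<open>v\<close> is the only maximizer, so \<open>u = v\<close>. But equal states give parallel
  lines, which do not meet.\<close>

lemma characteristics_do_not_cross:
  assumes "x < x'" "u \<in> U x t" "v \<in> U x' t" "0 < s" "s < t"
  shows "x - (t - s) * p u < x' - (t - s) * p v"
proof (rule ccontr)
  assume "\<not> ?thesis"
  then have *: "x' - x \<le> (t - s) * (p v - p u)" by (simp add: algebra_simps)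
  with assms(1) have "0 < (t - s) * (p v - p u)" by linarith
  then have pos: "0 < p v - p u" using assms(5) by (simp add: zero_less_mult_iff)
  \<comment> \<open>The time at which the two lines meet.\<close>
  define r where "r = t - (x' - x) / (p v - p u)"
  have r: "s \<le> r" "r < t" "(t - r) * (p v - p u) = x' - x"
    using * pos assms(1) by (auto simp: r_def field_simps)
  then have "x - (t - r) * p u = x' - (t - r) * p v" by (simp add: algebra_simps)
  moreover have "U (x - (t - r) * p u) r = {u}" "U (x' - (t - r) * p v) r = {v}"
    using maximizers_on_characteristic[OF assms(2)] maximizers_on_characteristic[OF assms(3)]
      assms(4) r by auto
  ultimately have "u = v" by auto
  with pos show False by simp
qed

text \<open>Upper semicontinuity of the maximizer sets: violations at points tending to
  \<open>x\<close> would accumulate at a maximizer of \<open>(x, t)\<close> outside the range from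
  \<open>umin x t\<close> to \<open>umax x t\<close>.\<close>

lemma maximizers_near:
  assumes "t > 0" "e > 0"
  obtains d where "d > 0" "\<And>y u. \<bar>y - x\<bar> < d \<Longrightarrow> u \<in> U y t \<Longrightarrow> umin x t - e < u \<and> u < umax x t + e"
proof (rule ccontr)
  note found = that
  assume "\<not> thesis"
  then have *: "\<exists>y u. \<bar>y - x\<bar> < d \<and> u \<in> U y t \<and> \<not> (umin x t - e < u \<and> u < umax x t + e)" if "d > 0" for d
    using that found by blast
  have "\<exists>y u. \<bar>y - x\<bar> < 1 / real (Suc n) \<and> u \<in> U y t \<and> \<not> (umin x t - e < u \<and> u < umax x t + e)" for n
    by (rule *) simp
  then obtain y u where yu: "\<And>n. \<bar>y n - x\<bar> < 1 / real (Suc n)" "\<And>n. u n \<in> U (y n) t"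
    "\<And>n. \<not> (umin x t - e < u n \<and> u n < umax x t + e)"
    by metis
  have "(\<lambda>n. y n - x) \<longlonglongrightarrow> 0"
    by (rule LIMSEQ_norm_0) (use yu(1) in simp)
  then have "y \<longlonglongrightarrow> x" using LIM_zero_iff by blast
  then obtain l r where l: "l \<in> U x t" "strict_mono r" "(u \<circ> r) \<longlonglongrightarrow> l"
    using maximizers_subsequence[of u y "\<lambda>_. t" x t] yu(2) assms(1) by (metis tendsto_const)
  have "eventually (\<lambda>n. (u \<circ> r) n \<in> {umin x t - e<..<umax x t + e}) sequentially"
    by (rule topological_tendstoD[OF l(3)])
      (use umin_le[OF assms(1) l(1)] umax_ge[OF assms(1) l(1)] assms(2) in auto)
  then show False
    using yu(3) by (auto dest!: eventually_happens)
qed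

text \<open>Semicontinuity bounds \<open>umin y t\<close> from above. From below, the characteristic
  of \<open>y\<close> must stay to the left of that of \<open>umax x t\<close>, so its speed cannot
  be much smaller.\<close>

lemma entropy_sol_at_left:
  assumes "t > 0"
  shows "((\<lambda>y. umin y t) \<longlongrightarrow> umax x t) (at_left x)"
proof (rule tendstoI)
  fix e :: real assume e: "e > 0"
  obtain d where d: "d > 0" "\<And>y u. \<bar>y - x\<bar> < d \<Longrightarrow> u \<in> U y t \<Longrightarrow> umin x t - e < u \<and> u < umax x t + e"
    using maximizers_near[OF assms e, of x] by blast
  \<comment> \<open>Non-crossing down to time \<open>t / 2\<close> limits the loss of speed to
    \<open>2 * (x - y) / t\<close>; the second entry keeps it below the drop from
    \<open>umax x t\<close> to \<open>umax x t - e\<close>.\<close>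
  define d' where "d' = min d (t / 2 * (p (umax x t) - p (umax x t - e)))"
  have d': "d' > 0" using d(1) e assms by (simp add: d'_def)
  have "dist (umin y t) (umax x t) < e" if "x - d' < y" "y < x" for y
  proof -
    have "umin y t < umax x t + e"
      using d(2)[OF _ umin_in[OF assms]] that by (auto simp: d'_def)
    moreover have "y - (t - t / 2) * p (umin y t) < x - (t - t / 2) * p (umax x t)"
      using assms that by (intro characteristics_do_not_cross umin_in umax_in) auto
    then have "t / 2 * p (umax x t - e) < t / 2 * p (umin y t)"
      using that by (auto simp: d'_def min_def algebra_simps split: if_splits)
    then have "umax x t - e < umin y t" using assms by simp
    ultimately show ?thesis by (simp add: dist_real_def abs_less_iff)
  qed
  then show "eventually (\<lambda>y. dist (umin y t) (umax x t) < e) (at_left x)"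
    using d' by (auto simp: eventually_at_left_field intro!: exI[of _ "x - d'"])
qed

lemma entropy_sol_at_right:
  assumes "t > 0"
  shows "((\<lambda>y. umin y t) \<longlongrightarrow> umin x t) (at_right x)"
proof (rule tendstoI)
  fix e :: real assume e: "e > 0"
  obtain d where d: "d > 0" "\<And>y u. \<bar>y - x\<bar> < d \<Longrightarrow> u \<in> U y t \<Longrightarrow> umin x t - e < u \<and> u < umax x t + e"
    using maximizers_near[OF assms e, of x] by blast
  define d' where "d' = min d (t / 2 * (p (umin x t + e) - p (umin x t)))"
  have d': "d' > 0" using d(1) e assms by (simp add: d'_def)
  have "dist (umin y t) (umin x t) < e" if "x < y" "y < x + d'" for y
  proof -
    have "umin x t - e < umin y t"
      using d(2)[OF _ umin_in[OF assms]] that by (auto simp: d'_def)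
    moreover have "x - (t - t / 2) * p (umin x t) < y - (t - t / 2) * p (umin y t)"
      using assms that by (intro characteristics_do_not_cross umin_in) auto
    then have "t / 2 * p (umin y t) < t / 2 * p (umin x t + e)"
      using that by (auto simp: d'_def min_def algebra_simps split: if_splits)
    then have "umin y t < umin x t + e" using assms by simp
    ultimately show ?thesis by (simp add: dist_real_def abs_less_iff)
  qed
  then show "eventually (\<lambda>y. dist (umin y t) (umin x t) < e) (at_right x)"
    using d' by (auto simp: eventually_at_right_field intro!: exI[of _ "x + d'"])
qed

lemma trace_left_eq: "t > 0 \<Longrightarrow> trace_left f \<phi> x t = umax x t"
  unfolding trace_left_def entropy_sol_def
  by (intro tendsto_Lim entropy_sol_at_left trivial_limit_at_left_real)

lemma trace_right_eq: "t > 0 \<Longrightarrow> trace_right f \<phi> x t = umin x t"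
  unfolding trace_right_def entropy_sol_def
  by (intro tendsto_Lim entropy_sol_at_right trivial_limit_at_right_real)

section \<open>Forward characteristics\<close>

abbreviation T :: "real \<Rightarrow> real \<Rightarrow> (real \<times> real) set" where "T \<equiv> char_triangle f \<phi>"

section \<open>Slices of the triangles at a fixed time\<close>

lemma Delta_iff: "(y, s) \<in> Delta f x t S \<longleftrightarrow> 0 < s \<and> s < t \<and> (\<exists>u\<in>S. y = x - (t - s) * p u)"
  by (auto simp: Delta_def char_line_def algebra_simps)

text \<open>By the intermediate value theorem the speeds fill an interval, and so does each slice.
  The order is reversed: a faster characteristic starts further left.\<close>

lemma Delta_Ioo_iff:
  "(y, s) \<in> Delta f x t {c<..<d} \<longleftrightarrow>
     0 < s \<and> s < t \<and> x - (t - s) * p d < y \<and> y < x - (t - s) * p c"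
proof (cases "0 < s \<and> s < t")
  case True
  have "\<exists>u\<in>{c<..<d}. y = x - (t - s) * p u"
    if "x - (t - s) * p d < y" "y < x - (t - s) * p c"
  proof -
    have q: "p c < (x - y) / (t - s)" "(x - y) / (t - s) < p d"
      using True that by (auto simp: field_simps)
    then obtain w where w: "p w = (x - y) / (t - s)"
      using p_intermediate by (meson less_imp_le)
    then have "c < w" "w < d" using q by (simp_all flip: w)
    then show ?thesis using w True by (intro bexI[of _ w]) auto
  qed
  then show ?thesis using True by (auto simp: Delta_iff)
qed (auto simp: Delta_iff)

lemma char_triangle_iff:
  "(y, s) \<in> T x t \<longleftrightarrow>
     0 < s \<and> s < t \<and> x - (t - s) * p (umax x t) \<le> y \<and> y \<le> x - (t - s) * p (umin x t)"
proof (cases "0 < s \<and> s < t")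
  case True
  then have I: "state_interval f \<phi> x t = {umin x t..umax x t}"
    by (simp add: state_interval_def trace_left_eq trace_right_eq)
  have "\<exists>u\<in>{umin x t..umax x t}. y = x - (t - s) * p u"
    if "x - (t - s) * p (umax x t) \<le> y" "y \<le> x - (t - s) * p (umin x t)"
  proof -
    have "p (umin x t) \<le> (x - y) / (t - s)" "(x - y) / (t - s) \<le> p (umax x t)"
      using True that by (auto simp: field_simps)
    then obtain w where "p w = (x - y) / (t - s)" "umin x t \<le> w" "w \<le> umax x t"
      by (rule p_intermediate)
    then show ?thesis using True by (intro bexI[of _ w]) auto
  qed
  then show ?thesis
    using True by (auto simp: char_triangle_def Delta_iff I mult_left_mono)
qed (auto simp: char_triangle_def Delta_iff)

text \<open>The extreme characteristics of two apexes at the same time do not cross, so their bases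
  are disjoint and ordered like the apexes.\<close>

lemma triangles_ordered:
  assumes "(y, s) \<in> T x t" "(y', s) \<in> T x' t" "y \<le> y'"
  shows "x \<le> x'"
proof (rule ccontr)
  assume "\<not> x \<le> x'"
  then have "x' - (t - s) * p (umin x' t) < x - (t - s) * p (umax x t)"
    using assms(1) by (intro characteristics_do_not_cross umin_in umax_in) (auto simp: char_triangle_iff)
  then show False using assms by (auto simp: char_triangle_iff)
qed

lemma triangle_unique:
  assumes "(y, s) \<in> T x t" "(y, s) \<in> T x' t"
  shows "x = x'"
  using triangles_ordered[OF assms] triangles_ordered[OF assms(2,1)] by simp

lemma speed_bound:
  obtains K where "K \<ge> 0" "\<And>t u x. t > 0 \<Longrightarrow> u \<in> U x t \<Longrightarrow> \<bar>p u\<bar> \<le> K"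
proof
  show "\<bar>p u\<bar> \<le> max \<bar>p C\<bar> \<bar>p (- C)\<bar>" if "t > 0" "u \<in> U x t" for t u x
  proof -
    have "p (- C) \<le> p u" "p u \<le> p C"
      using maximizers_bounded[OF that] by auto
    then show ?thesis by linarith
  qed
qed auto

text \<open>Here \<open>g x\<close> is the right edge of the base below \<open>x\<close>, monotone
  in \<open>x\<close>. At the supremum of the points with \<open>g x \<le> y\<close> the left limit
  of \<open>g\<close> is the left edge and the right limit is the right edge, so \<open>y\<close>
  lies between the two.\<close>

lemma triangle_exists:
  assumes "0 < s" "s < t"
  obtains x where "(y, s) \<in> T x t"
proof -
  define g where "g x = x - (t - s) * p (umin x t)" for x
  define S where "S = {x. g x \<le> y}"
  have t: "t > 0" using assms by simp
  have cont: "isCont p z" for z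
    using continuous_p by (auto simp: continuous_on_eq_continuous_at)
  have left: "(g \<longlongrightarrow> x - (t - s) * p (umax x t)) (at_left x)" for x
    unfolding g_def by (intro tendsto_intros isCont_tendsto_compose[OF cont] entropy_sol_at_left t)
  have right: "(g \<longlongrightarrow> g x) (at_right x)" for x
    unfolding g_def by (intro tendsto_intros isCont_tendsto_compose[OF cont] entropy_sol_at_right t)
  have mono: "g a \<le> g b" if "a < b" for a b
    unfolding g_def using characteristics_do_not_cross[OF that umin_in umin_in assms] t by (simp add: less_imp_le)
  \<comment> \<open>Finite speed of propagation makes \<open>S\<close> nonempty and bounded
    above.\<close>
  obtain K where K: "K \<ge> 0" "\<And>t u x. t > 0 \<Longrightarrow> u \<in> U x t \<Longrightarrow> \<bar>p u\<bar> \<le> K"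
    by (metis speed_bound)
  have near: "\<bar>g x - x\<bar> \<le> (t - s) * K" for x
    using K(2)[OF t umin_in[OF t]] assms by (simp add: g_def abs_mult mult_left_mono)
  have "y - (t - s) * K \<in> S"
    using near[of "y - (t - s) * K"] by (auto simp: S_def)
  then have ne: "S \<noteq> {}" by blast
  have "x \<le> y + (t - s) * K" if "x \<in> S" for x
    using near[of x] that by (auto simp: S_def)
  then have bdd: "bdd_above S" by (rule bdd_aboveI)
  have "Sup S - (t - s) * p (umax (Sup S) t) \<le> y"
  proof (rule tendsto_upperbound[OF left])
    have "g z \<le> y" if z: "z < Sup S" for z
    proof -
      obtain w where "w \<in> S" "z < w" using less_cSupE[OF z ne] by blast
      then show ?thesis using mono[of z w] by (auto simp: S_def)
    qed
    then show "eventually (\<lambda>z. g z \<le> y) (at_left (Sup S))"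
      by (auto simp: eventually_at_left_field intro!: exI[of _ "Sup S - 1"])
  qed simp
  moreover have "y \<le> g (Sup S)"
  proof (rule tendsto_lowerbound[OF right])
    have "y \<le> g z" if z: "Sup S < z" for z
      using cSup_upper[OF _ bdd, of z] z by (force simp: S_def)
    then show "eventually (\<lambda>z. y \<le> g z) (at_right (Sup S))"
      by (auto simp: eventually_at_right_field intro!: exI[of _ "Sup S + 1"])
  qed simp
  ultimately show ?thesis
    using that[of "Sup S"] assms by (simp add: char_triangle_iff g_def)
qed

text \<open>The edges of \<open>T x t\<close> are maximizing characteristics, so at time
  \<open>s\<close> each still carries its state as the only maximizer. The edges of
  \<open>T y s\<close> cannot cross them.\<close>

lemma triangle_subset:
  assumes "(y, s) \<in> T x t"
  shows "T y s \<subseteq> T x t"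
proof clarify
  fix z r assume zr: "(z, r) \<in> T y s"
  have s: "0 < s" "s < t" "0 < t" using assms by (auto simp: char_triangle_iff)
  have r: "0 < r" "r < s" using zr by (auto simp: char_triangle_iff)
  have "x - (t - r) * p (umax x t) \<le> z"
  proof -
    let ?y = "x - (t - s) * p (umax x t)"
    have eq: "x - (t - r) * p (umax x t) = ?y - (s - r) * p (umax x t)" by (simp add: algebra_simps)
    have U: "U ?y s = {umax x t}" by (rule maximizers_on_characteristic[OF umax_in[OF s(3)] s(1,2)])
    have "?y - (s - r) * p (umax x t) \<le> y - (s - r) * p (umax y s)"
    proof (cases "?y = y")
      case True
      then show ?thesis using U by (metis cSup_singleton order_refl)
    next
      case False
      then have "?y < y" using assms by (simp add: char_triangle_iff)
      then show ?thesis
        using characteristics_do_not_cross[of ?y y "umax x t" s "umax y s" r] U umax_in s r by auto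
    qed
    also have "\<dots> \<le> z" using zr by (simp add: char_triangle_iff)
    finally show ?thesis unfolding eq .
  qed
  moreover have "z \<le> x - (t - r) * p (umin x t)"
  proof -
    let ?y = "x - (t - s) * p (umin x t)"
    have eq: "x - (t - r) * p (umin x t) = ?y - (s - r) * p (umin x t)" by (simp add: algebra_simps)
    have U: "U ?y s = {umin x t}" by (rule maximizers_on_characteristic[OF umin_in[OF s(3)] s(1,2)])
    have "z \<le> y - (s - r) * p (umin y s)" using zr by (simp add: char_triangle_iff)
    also have "\<dots> \<le> ?y - (s - r) * p (umin x t)"
    proof (cases "?y = y")
      case True
      then show ?thesis using U by (metis cInf_singleton order_refl)
    next
      case False
      then have "y < ?y" using assms by (simp add: char_triangle_iff)
      then show ?thesis
        using characteristics_do_not_cross[of y ?y "umin y s" s "umin x t" r] U umin_in s r by auto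
    qed
    finally show ?thesis unfolding eq .
  qed
  ultimately show "(z, r) \<in> T x t" using s r by (simp add: char_triangle_iff)
qed

text \<open>Some apex at time \<open>t\<close> has \<open>(x', t')\<close> in its triangle, hence
  also \<open>(y, s)\<close> by nesting; uniqueness of the apex identifies it with
  \<open>x\<close>.\<close>

lemma triangle_between:
  assumes "(y, s) \<in> T x t" "(y, s) \<in> T x' t'" "t' < t"
  shows "(x', t') \<in> T x t"
proof -
  have "0 < t'" using assms(2) by (auto simp: char_triangle_iff)
  then obtain z where z: "(x', t') \<in> T z t" using triangle_exists assms(3) by blast
  then have "(y, s) \<in> T z t" using triangle_subset assms(2) by blast
  then show ?thesis using triangle_unique assms(1) z by blast
qed

text \<open>The nesting of all triangles along the curve reduces to membership of the starting point
  in each of them, which determines the curve separately at every time.\<close>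

lemma is_forward_char_iff:
  assumes "t > 0"
  shows "is_forward_char f \<phi> x t X \<longleftrightarrow> X t = x \<and> (\<forall>\<tau>>t. (x, t) \<in> T (X \<tau>) \<tau>)"
proof (intro iffI conjI allI impI)
  assume X: "is_forward_char f \<phi> x t X"
  then show "X t = x" by (simp add: is_forward_char_def)
  fix \<tau> assume \<tau>: "\<tau> > t"
  have sub: "T x t \<subseteq> T (X \<tau>) \<tau>"
    using X \<tau> unfolding is_forward_char_def by (meson lt_ex gt_ex)
  \<comment> \<open>A triangle does not contain its apex, so \<open>(x, t)\<close> is reached as the
    limit of points on the left edge of \<open>T x t\<close>.\<close>
  have *: "X \<tau> - (\<tau> - r) * p (umax (X \<tau>) \<tau>) \<le> x - (t - r) * p (umax x t) \<and>
    x - (t - r) * p (umax x t) \<le> X \<tau> - (\<tau> - r) * p (umin (X \<tau>) \<tau>)" if "0 < r" "r < t" for r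
  proof -
    have "(x - (t - r) * p (umax x t), r) \<in> T x t"
      using that umin_le_umax[OF assms] by (simp add: char_triangle_iff mult_left_mono)
    then have "(x - (t - r) * p (umax x t), r) \<in> T (X \<tau>) \<tau>" using sub by blast
    then show ?thesis by (simp add: char_triangle_iff)
  qed
  have ev: "eventually (\<lambda>r. 0 < r \<and> r < t) (at_left t)"
    using assms by (auto simp: eventually_at_left_field)
  have l: "((\<lambda>r. x - (t - r) * p (umax x t)) \<longlongrightarrow> x - (t - t) * p (umax x t)) (at_left t)"
    by (intro tendsto_intros)
  have edge: "((\<lambda>r. X \<tau> - (\<tau> - r) * p u) \<longlongrightarrow> X \<tau> - (\<tau> - t) * p u) (at_left t)" for u
    by (intro tendsto_intros)
  have "X \<tau> - (\<tau> - t) * p (umax (X \<tau>) \<tau>) \<le> x - (t - t) * p (umax x t)"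
    by (rule tendsto_le[OF _ l edge]) (auto intro!: eventually_mono[OF ev] simp: *)
  moreover have "x - (t - t) * p (umax x t) \<le> X \<tau> - (\<tau> - t) * p (umin (X \<tau>) \<tau>)"
    by (rule tendsto_le[OF _ edge l]) (auto intro!: eventually_mono[OF ev] simp: *)
  ultimately show "(x, t) \<in> T (X \<tau>) \<tau>" using assms \<tau> by (simp add: char_triangle_iff)
next
  assume X: "X t = x \<and> (\<forall>\<tau>>t. (x, t) \<in> T (X \<tau>) \<tau>)"
  show "is_forward_char f \<phi> x t X"
    unfolding is_forward_char_def
  proof (intro conjI allI impI)
    show "X t = x" using X by simp
    fix t1 t2 assume t: "t < t1 \<and> t1 < t2"
    show "T x t \<subseteq> T (X t1) t1" using X t by (intro triangle_subset) auto
    have "(x, t) \<in> T (X t1) t1" "(x, t) \<in> T (X t2) t2" using X t by auto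
    then have "(X t1, t1) \<in> T (X t2) t2" using triangle_between t by blast
    then show "T (X t1) t1 \<subseteq> T (X t2) t2" by (rule triangle_subset)
  qed
qed

abbreviation fwd :: "real \<Rightarrow> real \<Rightarrow> real \<Rightarrow> real" where "fwd \<equiv> forward_char f \<phi>"

text \<open>Covering by triangles gives existence at each time and disjointness of their bases gives
  uniqueness, so the definite description is legitimate.\<close>

lemma is_forward_char_fwd:
  assumes "t > 0"
  shows "is_forward_char f \<phi> x t (fwd x t)"
proof -
  have "\<exists>!X. X \<in> extensional {t..} \<and> is_forward_char f \<phi> x t X"
  proof (rule ex_ex1I)
    have "\<forall>\<tau>. \<exists>x'. \<tau> > t \<longrightarrow> (x, t) \<in> T x' \<tau>" by (meson assms triangle_exists)
    then obtain X where X: "\<And>\<tau>. \<tau> > t \<Longrightarrow> (x, t) \<in> T (X \<tau>) \<tau>" by metis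
    show "\<exists>X. X \<in> extensional {t..} \<and> is_forward_char f \<phi> x t X"
      using X by (intro exI[of _ "restrict (X(t := x)) {t..}"]) (simp add: is_forward_char_iff[OF assms])
  next
    fix X Y assume XY: "X \<in> extensional {t..} \<and> is_forward_char f \<phi> x t X"
      "Y \<in> extensional {t..} \<and> is_forward_char f \<phi> x t Y"
    show "X = Y"
    proof (rule extensionalityI)
      fix \<tau> assume "\<tau> \<in> {t..}"
      then show "X \<tau> = Y \<tau>"
        using XY triangle_unique unfolding is_forward_char_iff[OF assms]
        by (metis atLeast_iff order_le_less)
    qed (use XY in auto)
  qed
  from theI'[OF this] show ?thesis by (simp add: forward_char_def)
qed

lemma fwd_start: "t > 0 \<Longrightarrow> fwd x t t = x"
  and fwd_triangle: "t > 0 \<Longrightarrow> t < \<tau> \<Longrightarrow> (x, t) \<in> T (fwd x t \<tau>) \<tau>"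
  using is_forward_char_fwd is_forward_char_iff by blast+

lemma fwd_eq_iff:
  assumes "0 < s" "s < t"
  shows "fwd y s t = x \<longleftrightarrow> (y, s) \<in> T x t"
  using fwd_triangle[OF assms] triangle_unique by blast

lemma fwd_fwd_triangle:
  assumes "0 < s" "s \<le> t" "t < \<tau>"
  shows "(fwd y s t, t) \<in> T (fwd y s \<tau>) \<tau>"
proof (cases "s = t")
  case True
  then show ?thesis using fwd_start fwd_triangle assms by simp
next
  case False
  then show ?thesis
    using assms by (intro triangle_between[OF fwd_triangle fwd_triangle]) auto
qed

lemma fwd_fwd:
  assumes "0 < s" "s \<le> t" "t \<le> \<tau>"
  shows "fwd (fwd y s t) t \<tau> = fwd y s \<tau>"
proof (cases "t = \<tau>")
  case True
  then show ?thesis using fwd_start assms by simp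
next
  case False
  then show ?thesis using fwd_fwd_triangle assms by (subst fwd_eq_iff) auto
qed

lemma triangle_speed:
  assumes "\<And>t u x. t > 0 \<Longrightarrow> u \<in> U x t \<Longrightarrow> \<bar>p u\<bar> \<le> K" "(y, s) \<in> T x t"
  shows "\<bar>y - x\<bar> \<le> K * (t - s)"
proof -
  have t: "0 < t" "0 < t - s" using assms(2) by (auto simp: char_triangle_iff)
  have "\<bar>p (umax x t)\<bar> \<le> K" "\<bar>p (umin x t)\<bar> \<le> K" using assms(1) t umin_in umax_in by blast+
  then have "(t - s) * p (umax x t) \<le> (t - s) * K" "(t - s) * - K \<le> (t - s) * p (umin x t)"
    using t by - (rule mult_left_mono; linarith)+
  moreover have "x - (t - s) * p (umax x t) \<le> y" "y \<le> x - (t - s) * p (umin x t)"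
    using assms(2) by (simp_all add: char_triangle_iff)
  ultimately show ?thesis unfolding mult.commute[of K] by linarith
qed

text \<open>Each earlier point of the curve lies in the triangle of each later one, so the bound on
  the characteristic speeds is a Lipschitz constant.\<close>

lemma continuous_fwd:
  assumes "0 < s"
  shows "continuous_on {s..} (fwd y s)"
proof -
  obtain K where K: "K \<ge> 0" "\<And>t u x. t > 0 \<Longrightarrow> u \<in> U x t \<Longrightarrow> \<bar>p u\<bar> \<le> K"
    by (metis speed_bound)
  have *: "\<bar>fwd y s a - fwd y s b\<bar> \<le> K * \<bar>a - b\<bar>" if "s \<le> a" "a \<le> b" for a b
  proof (cases "a = b")
    case False
    then show ?thesis
      using triangle_speed[OF K(2) fwd_fwd_triangle[OF assms that(1), of b y]] that by simp
  qed simp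
  have "K-lipschitz_on {s..} (fwd y s)"
  proof (rule lipschitz_onI)
    fix a b assume "a \<in> {s..}" "b \<in> {s..}"
    then show "dist (fwd y s a) (fwd y s b) \<le> K * dist a b"
      using *[of a b] *[of b a] by (cases "a \<le> b") (auto simp: dist_real_def abs_minus_commute)
  qed (rule K)
  then show ?thesis by (rule lipschitz_on_continuous_on)
qed

section \<open>Gaps and intervals of maximizers\<close>

text \<open>Without a jump at \<open>(x, t)\<close> its triangle is a single characteristic, and
  along that line the maximizer is unique.\<close>

lemma discontinuity_persists:
  assumes "umin y s < umax y s" "(y, s) \<in> T x t"
  shows "umin x t < umax x t"
proof (rule ccontr)
  assume "\<not> ?thesis"
  moreover have st: "0 < s" "s < t" using assms(2) by (auto simp: char_triangle_iff)
  ultimately have eq: "umax x t = umin x t" using umin_le_umax[of t x] by simp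
  then have "y = x - (t - s) * p (umin x t)" using assms(2) by (simp add: char_triangle_iff)
  then have "U y s = {umin x t}" using maximizers_on_characteristic umin_in st by simp
  then show False using assms(1) by simp
qed

section \<open>The region below a gap of the maximizers\<close>

context
  fixes x\<^sub>0 t\<^sub>0 c d :: real
  assumes t\<^sub>0: "t\<^sub>0 > 0" and c: "c \<in> U x\<^sub>0 t\<^sub>0" and d: "d \<in> U x\<^sub>0 t\<^sub>0"
    and gap: "{c<..<d} \<inter> U x\<^sub>0 t\<^sub>0 = {}"
begin

abbreviation R :: "(real \<times> real) set" where "R \<equiv> Delta f x\<^sub>0 t\<^sub>0 {c<..<d}"

lemma gap_subset_triangle: "R \<subseteq> T x\<^sub>0 t\<^sub>0"
proof clarify
  fix y s assume y: "(y, s) \<in> R"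
  then have st: "0 < s" "s < t\<^sub>0" by (auto simp: Delta_Ioo_iff)
  then have "(t\<^sub>0 - s) * p d \<le> (t\<^sub>0 - s) * p (umax x\<^sub>0 t\<^sub>0)" "(t\<^sub>0 - s) * p (umin x\<^sub>0 t\<^sub>0) \<le> (t\<^sub>0 - s) * p c"
    using umin_le[OF t\<^sub>0 c] umax_ge[OF t\<^sub>0 d] by (auto intro!: mult_left_mono)
  moreover have "x\<^sub>0 - (t\<^sub>0 - s) * p d < y" "y < x\<^sub>0 - (t\<^sub>0 - s) * p c"
    using y by (simp_all add: Delta_Ioo_iff)
  ultimately show "(y, s) \<in> T x\<^sub>0 t\<^sub>0"
    unfolding char_triangle_iff using st by - (intro conjI; linarith)
qed

text \<open>The lines of \<open>c\<close> and \<open>d\<close> carry unique maximizers before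
  \<open>t\<^sub>0\<close>. Had the curve reached one of them by time \<open>t\<close>, non-crossing
  would put its whole triangle at time \<open>s\<close> on or beyond that line, away from
  \<open>y\<close>.\<close>

lemma fwd_in_gap:
  assumes "(y, s) \<in> R" "s \<le> t" "t < t\<^sub>0"
  shows "(fwd y s t, t) \<in> R"
proof (cases "s = t")
  case True
  then show ?thesis using assms fwd_start by (auto simp: Delta_Ioo_iff)
next
  case False
  then have st: "0 < s" "s < t" "0 < t" using assms by (auto simp: Delta_Ioo_iff)
  let ?x = "fwd y s t"
  have tri: "(y, s) \<in> T ?x t" by (rule fwd_triangle[OF st(1,2)])
  have single: "U (x\<^sub>0 - (t\<^sub>0 - t) * p u) t = {u}" if "u \<in> U x\<^sub>0 t\<^sub>0" for u
    using that st(3) assms(3) by (rule maximizers_on_characteristic)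
  have foot: "x\<^sub>0 - (t\<^sub>0 - t) * p u - (t - s) * p u = x\<^sub>0 - (t\<^sub>0 - s) * p u" for u
    by (simp add: algebra_simps)
  have "?x < x\<^sub>0 - (t\<^sub>0 - t) * p c"
  proof (rule ccontr)
    let ?z = "x\<^sub>0 - (t\<^sub>0 - t) * p c"
    assume "\<not> ?thesis"
    then have "?z - (t - s) * p c \<le> ?x - (t - s) * p (umax ?x t)"
      using characteristics_do_not_cross[of ?z ?x c t "umax ?x t" s] single[OF c] umax_in st
      by (cases "?z = ?x") auto
    then show False using tri assms(1) unfolding foot by (auto simp: Delta_Ioo_iff char_triangle_iff)
  qed
  moreover have "x\<^sub>0 - (t\<^sub>0 - t) * p d < ?x"
  proof (rule ccontr)
    let ?z = "x\<^sub>0 - (t\<^sub>0 - t) * p d"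
    assume "\<not> ?thesis"
    then have "?x - (t - s) * p (umin ?x t) \<le> ?z - (t - s) * p d"
      using characteristics_do_not_cross[of ?x ?z "umin ?x t" t d s] single[OF d] umin_in st
      by (cases "?x = ?z") auto
    then show False using tri assms(1) unfolding foot by (auto simp: Delta_Ioo_iff char_triangle_iff)
  qed
  ultimately show ?thesis using st assms(3) by (simp add: Delta_Ioo_iff)
qed

text \<open>
  Maximizing characteristics issued from points tending to \<open>(x\<^sub>0, t\<^sub>0)\<close> accumulate only at those of
  \<open>(x\<^sub>0, t\<^sub>0)\<close> itself, none of which enters the gap.
\<close>

lemma gap_avoided:
  assumes "(a, s) \<in> R" "(b, s) \<in> R"
  obtains t where "s < t" "t < t\<^sub>0"
    "\<And>x v. (x, t) \<in> T x\<^sub>0 t\<^sub>0 \<Longrightarrow> v \<in> U x t \<Longrightarrow> x - (t - s) * p v \<notin> {a..b}"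
proof (rule ccontr)
  note found = that
  assume "\<not> thesis"
  then have *: "\<exists>x v. (x, t) \<in> T x\<^sub>0 t\<^sub>0 \<and> v \<in> U x t \<and> x - (t - s) * p v \<in> {a..b}"
    if "s < t" "t < t\<^sub>0" for t
    using that found by blast
  have s: "0 < s" "s < t\<^sub>0" using assms by (auto simp: Delta_Ioo_iff)
  \<comment> \<open>Times increasing to \<open>t\<^sub>0\<close>; the double successor keeps the
    factor below \<open>1\<close>, so that \<open>s < \<tau> n\<close> holds already for
    \<open>n = 0\<close>.\<close>
  define \<tau> where "\<tau> n = t\<^sub>0 - (t\<^sub>0 - s) * inverse (real (Suc (Suc n)))" for n
  have \<tau>: "s < \<tau> n" "\<tau> n < t\<^sub>0" for n
  proof -
    have "(t\<^sub>0 - s) * inverse (real (Suc (Suc n))) < (t\<^sub>0 - s) * 1"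
      using s(2) by (intro mult_strict_left_mono) (auto simp: inverse_less_1_iff)
    then show "s < \<tau> n" by (simp add: \<tau>_def)
    show "\<tau> n < t\<^sub>0" using s(2) by (simp add: \<tau>_def)
  qed
  have "\<tau> \<longlonglongrightarrow> t\<^sub>0 - (t\<^sub>0 - s) * 0"
    unfolding \<tau>_def by (intro tendsto_intros LIMSEQ_Suc[OF LIMSEQ_inverse_real_of_nat])
  then have \<tau>_lim: "\<tau> \<longlonglongrightarrow> t\<^sub>0" by simp
  have "\<exists>x v. (x, \<tau> n) \<in> T x\<^sub>0 t\<^sub>0 \<and> v \<in> U x (\<tau> n) \<and> x - (\<tau> n - s) * p v \<in> {a..b}" for n
    using * \<tau> by blast
  then obtain x v where xv: "\<And>n. (x n, \<tau> n) \<in> T x\<^sub>0 t\<^sub>0" "\<And>n. v n \<in> U (x n) (\<tau> n)"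
    "\<And>n. x n - (\<tau> n - s) * p (v n) \<in> {a..b}"
    by metis
  obtain K where K: "K \<ge> 0" "\<And>t u x. t > 0 \<Longrightarrow> u \<in> U x t \<Longrightarrow> \<bar>p u\<bar> \<le> K"
    by (metis speed_bound)
  have bd: "norm (x n - x\<^sub>0) \<le> K * (t\<^sub>0 - \<tau> n)" for n
    using triangle_speed[OF K(2) xv(1)[of n]] by simp
  have "(\<lambda>n. K * (t\<^sub>0 - \<tau> n)) \<longlonglongrightarrow> K * (t\<^sub>0 - t\<^sub>0)" by (intro tendsto_intros \<tau>_lim)
  then have "(\<lambda>n. K * (t\<^sub>0 - \<tau> n)) \<longlonglongrightarrow> 0" by simp
  with always_eventually[OF allI[OF bd]] have "(\<lambda>n. x n - x\<^sub>0) \<longlonglongrightarrow> 0"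
    by (rule Lim_null_comparison)
  then have x_lim: "x \<longlonglongrightarrow> x\<^sub>0" using LIM_zero_iff by blast
  obtain l r where l: "l \<in> U x\<^sub>0 t\<^sub>0" "strict_mono r" "(v \<circ> r) \<longlonglongrightarrow> l"
    using maximizers_subsequence[OF xv(2) _ x_lim \<tau>_lim t\<^sub>0] \<tau> s(1) by (metis less_trans)
  have "isCont p l" using continuous_p by (auto simp: continuous_on_eq_continuous_at)
  moreover have "(x \<circ> r) \<longlonglongrightarrow> x\<^sub>0" "(\<tau> \<circ> r) \<longlonglongrightarrow> t\<^sub>0"
    using x_lim \<tau>_lim l(2) LIMSEQ_subseq_LIMSEQ by blast+
  ultimately have "(\<lambda>n. (x \<circ> r) n - ((\<tau> \<circ> r) n - s) * p ((v \<circ> r) n)) \<longlonglongrightarrow> x\<^sub>0 - (t\<^sub>0 - s) * p l"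
    by (intro tendsto_intros isCont_tendsto_compose[of _ p] l(3))
  then have "x\<^sub>0 - (t\<^sub>0 - s) * p l \<in> {a..b}"
    by (rule closed_sequentially[OF closed_atLeastAtMost, rotated]) (use xv(3) in auto)
  moreover have "x\<^sub>0 - (t\<^sub>0 - s) * p d < a" "b < x\<^sub>0 - (t\<^sub>0 - s) * p c"
    using assms by (simp_all add: Delta_Ioo_iff)
  ultimately have "(t\<^sub>0 - s) * p l < (t\<^sub>0 - s) * p d" "(t\<^sub>0 - s) * p c < (t\<^sub>0 - s) * p l"
    unfolding atLeastAtMost_iff
    by linarith+
  then have "l \<in> {c<..<d}" using s by simp
  then show False using gap l(1) by blast
qed

lemma gap_fwd_target:
  assumes "(y, s) \<in> R"
  shows "fwd y s t\<^sub>0 = x\<^sub>0"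
  using assms gap_subset_triangle by (subst fwd_eq_iff) (auto simp: Delta_Ioo_iff)

text \<open>Apply \<open>gap_avoided\<close> with \<open>a = b = y\<close>: at time
  \<open>\<tau>\<close> the triangle of the curve contains \<open>(y, s)\<close> although no
  maximizing characteristic passes through it. Hence the triangle is not a single line, and the jump
  persists.\<close>

lemma gap_fwd_discontinuous:
  assumes "(y, s) \<in> R"
  obtains \<tau> where "s \<le> \<tau>" "\<tau> < t\<^sub>0"
    "\<And>t. \<tau> < t \<Longrightarrow> t \<le> t\<^sub>0 \<Longrightarrow> umin (fwd y s t) t < umax (fwd y s t) t"
proof -
  have s: "0 < s" using assms by (auto simp: Delta_Ioo_iff)
  obtain \<tau> where \<tau>: "s < \<tau>" "\<tau> < t\<^sub>0"
    "\<And>x v. (x, \<tau>) \<in> T x\<^sub>0 t\<^sub>0 \<Longrightarrow> v \<in> U x \<tau> \<Longrightarrow> x - (\<tau> - s) * p v \<notin> {y..y}"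
    using gap_avoided[OF assms assms] by blast
  let ?x = "fwd y s \<tau>"
  have "(?x, \<tau>) \<in> T x\<^sub>0 t\<^sub>0" using fwd_in_gap[OF assms] gap_subset_triangle \<tau> by auto
  then have "?x - (\<tau> - s) * p (umin ?x \<tau>) \<notin> {y..y}"
    using \<tau>(1,3) s umin_in by simp
  moreover have "(y, s) \<in> T ?x \<tau>" using fwd_triangle s \<tau>(1) by blast
  ultimately have "umin ?x \<tau> \<noteq> umax ?x \<tau>" by (auto simp: char_triangle_iff)
  then have jump: "umin ?x \<tau> < umax ?x \<tau>" using umin_le_umax[of \<tau> ?x] \<tau>(1) s by simp
  show ?thesis
    using that[of \<tau>] \<tau>(1,2) s discontinuity_persists[OF jump fwd_fwd_triangle] by simp
qed

text \<open>If the curves were still apart at time \<open>t\<close>, the right edge of the left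
  triangle would reach time \<open>s\<close> at or to the right of \<open>a\<close> and to the left
  of \<open>b\<close>, which \<open>gap_avoided\<close> forbids.\<close>

lemma gap_fwd_merge_ordered:
  assumes "(a, s) \<in> R" "(b, s) \<in> R" "a \<le> b"
  obtains t where "s < t" "t < t\<^sub>0" "fwd a s t = fwd b s t"
proof -
  have s: "0 < s" using assms by (auto simp: Delta_Ioo_iff)
  obtain t where t: "s < t" "t < t\<^sub>0"
    "\<And>x v. (x, t) \<in> T x\<^sub>0 t\<^sub>0 \<Longrightarrow> v \<in> U x t \<Longrightarrow> x - (t - s) * p v \<notin> {a..b}"
    using gap_avoided[OF assms(1,2)] by blast
  have tri: "(a, s) \<in> T (fwd a s t) t" "(b, s) \<in> T (fwd b s t) t"
    using fwd_triangle s t(1) by blast+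
  have "\<not> fwd a s t < fwd b s t"
  proof
    assume "fwd a s t < fwd b s t"
    then have "fwd a s t - (t - s) * p (umin (fwd a s t) t) < fwd b s t - (t - s) * p (umax (fwd b s t) t)"
      using s t(1) by (intro characteristics_do_not_cross umin_in umax_in) auto
    moreover have "(fwd a s t, t) \<in> T x\<^sub>0 t\<^sub>0"
      using fwd_in_gap[OF assms(1)] gap_subset_triangle t(1,2) by auto
    then have "fwd a s t - (t - s) * p (umin (fwd a s t) t) \<notin> {a..b}"
      using s t(1) by (intro t(3) umin_in) auto
    ultimately show False using tri by (auto simp: char_triangle_iff)
  qed
  then show ?thesis
    using that[of t] t(1,2) triangles_ordered[OF tri assms(3)] by simp
qed

lemma gap_fwd_merge:
  assumes "(y\<^sub>1, s\<^sub>1) \<in> R" "(y\<^sub>2, s\<^sub>2) \<in> R"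
  obtains \<tau> where "max s\<^sub>1 s\<^sub>2 < \<tau>" "\<tau> < t\<^sub>0"
    "\<And>t. \<tau> \<le> t \<Longrightarrow> fwd y\<^sub>1 s\<^sub>1 t = fwd y\<^sub>2 s\<^sub>2 t"
proof -
  let ?s = "max s\<^sub>1 s\<^sub>2"
  have s: "0 < s\<^sub>1" "0 < s\<^sub>2" "?s < t\<^sub>0" using assms by (auto simp: Delta_Ioo_iff)
  \<comment> \<open>Both curves are followed to the later of the two starting times, where the case
    of equal times applies.\<close>
  have R: "(fwd y\<^sub>1 s\<^sub>1 ?s, ?s) \<in> R" "(fwd y\<^sub>2 s\<^sub>2 ?s, ?s) \<in> R"
    using assms s(3) by (auto intro!: fwd_in_gap)
  obtain \<tau> where \<tau>: "?s < \<tau>" "\<tau> < t\<^sub>0" "fwd (fwd y\<^sub>1 s\<^sub>1 ?s) ?s \<tau> = fwd (fwd y\<^sub>2 s\<^sub>2 ?s) ?s \<tau>"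
    using gap_fwd_merge_ordered[OF R] gap_fwd_merge_ordered[OF R(2,1)] by (metis linear)
  have eq: "fwd y\<^sub>1 s\<^sub>1 \<tau> = fwd y\<^sub>2 s\<^sub>2 \<tau>"
    using \<tau> s fwd_fwd[of s\<^sub>1 ?s \<tau> y\<^sub>1] fwd_fwd[of s\<^sub>2 ?s \<tau> y\<^sub>2] by auto
  have "fwd y\<^sub>1 s\<^sub>1 t = fwd y\<^sub>2 s\<^sub>2 t" if "\<tau> \<le> t" for t
    using fwd_fwd[of s\<^sub>1 \<tau> t y\<^sub>1] fwd_fwd[of s\<^sub>2 \<tau> t y\<^sub>2] eq that s \<tau>(1) by simp
  then show ?thesis using that \<tau> by blast
qed

lemma discontinuities_gap_iff:
  "(y, s) \<in> discontinuities f \<phi> R \<longleftrightarrow> (y, s) \<in> R \<and> umin y s < umax y s"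
  by (auto simp: discontinuities_def Delta_Ioo_iff trace_left_eq trace_right_eq)

text \<open>The path is the forward characteristic itself: it is continuous, stays in the gap region
  and keeps its jump.\<close>

lemma path_component_fwd:
  assumes "(y, s) \<in> discontinuities f \<phi> R" "s \<le> t" "t < t\<^sub>0"
  shows "path_component (discontinuities f \<phi> R) (y, s) (fwd y s t, t)"
proof -
  have R: "(y, s) \<in> R" and jump: "umin y s < umax y s"
    using assms(1) by (auto simp: discontinuities_gap_iff)
  then have s: "0 < s" by (auto simp: Delta_Ioo_iff)
  let ?curve = "(\<lambda>r. (fwd y s r, r)) ` {s..t}"
  have "?curve \<subseteq> discontinuities f \<phi> R"
  proof clarify
    fix r assume r: "r \<in> {s..t}"
    then have "(fwd y s r, r) \<in> R" using fwd_in_gap[OF R] assms(3) by auto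
    moreover have "umin (fwd y s r) r < umax (fwd y s r) r"
      using discontinuity_persists[OF jump fwd_triangle[OF s]] jump fwd_start[OF s] r
      by (cases "r = s") auto
    ultimately show "(fwd y s r, r) \<in> discontinuities f \<phi> R" by (simp add: discontinuities_gap_iff)
  qed
  moreover have "path_connected ?curve"
    using continuous_on_subset[OF continuous_fwd[OF s]]
    by (intro path_connected_continuous_image continuous_intros) (auto simp: is_interval_path_connected)
  moreover have "(y, s) \<in> ?curve" "(fwd y s t, t) \<in> ?curve"
    using fwd_start[OF s] assms(2) by (auto simp: image_iff intro!: bexI[of _ s])
  ultimately show ?thesis
    by (meson path_component_of_subset path_connected_component)
qed

lemma path_connected_discontinuities_gap: "path_connected (discontinuities f \<phi> R)"
  unfolding path_connected_component
proof clarify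
  fix y\<^sub>1 s\<^sub>1 y\<^sub>2 s\<^sub>2 assume D: "(y\<^sub>1, s\<^sub>1) \<in> discontinuities f \<phi> R" "(y\<^sub>2, s\<^sub>2) \<in> discontinuities f \<phi> R"
  then obtain \<tau> where \<tau>: "max s\<^sub>1 s\<^sub>2 < \<tau>" "\<tau> < t\<^sub>0" "fwd y\<^sub>1 s\<^sub>1 \<tau> = fwd y\<^sub>2 s\<^sub>2 \<tau>"
    using gap_fwd_merge unfolding discontinuities_gap_iff by (metis order_refl)
  then show "path_component (discontinuities f \<phi> R) (y\<^sub>1, s\<^sub>1) (y\<^sub>2, s\<^sub>2)"
    using path_component_fwd[OF D(1), of \<tau>] path_component_sym[OF path_component_fwd[OF D(2), of \<tau>]]
    by (auto intro: path_component_trans)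
qed

end

text \<open>All states in \<open>{a..b}\<close> have equal \<open>cost\<close>, so
  \<open>primitive\<close> at their feet is determined by \<open>G\<close>. Then
  \<open>G_bounds\<close> traps its right difference quotients at the foot of \<open>u\<close>
  between a nearby smaller state and \<open>u\<close>.\<close>

lemma datum_on_maximizing_interval:
  assumes "t > 0" "a < b" "{a<..<b} \<subseteq> U x t"
  shows "AE y in lebesgue. y \<in> {x - t * p b..x - t * p a} \<longrightarrow> \<phi> y = inv p ((x - y) / t)"
proof -
  have "closure {a<..<b} \<subseteq> U x t"
    using assms(3) compact_imp_closed[OF compact_maximizers[OF assms(1)]] by (rule closure_minimal)
  then have in_U: "u \<in> U x t" if "u \<in> {a..b}" for u using assms(2) that by auto
  have G_diff: "primitive (x - t * p w) - primitive (x - t * p u) = t * (G u - G w)"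
    if "u \<in> {a..b}" "w \<in> {a..b}" for u w
  proof -
    have "cost u x t = cost w x t"
      using in_U[OF that(1)] in_U[OF that(2)] by (auto simp: maximizers_iff[OF assms(1)] intro: antisym)
    then show ?thesis by (simp add: cost_def algebra_simps)
  qed
  have "\<phi> integrable_on cbox r s" for r s using integrable_datum by simp
  \<comment> \<open>Lebesgue differentiation: off a null set the right difference quotients of the
    integral tend to \<open>\<phi>\<close>.\<close>
  from integrable_ccontinuous_explicit[OF this] obtain N where N: "negligible N"
    "\<And>y e. y \<notin> N \<Longrightarrow> 0 < e \<Longrightarrow> \<exists>\<delta>>0. \<forall>h. 0 < h \<and> h < \<delta> \<longrightarrow>
       norm (integral (cbox y (y + h *\<^sub>R One)) \<phi> /\<^sub>R h ^ DIM(real) - \<phi> y) < e"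
    by blast
  have N': "\<exists>\<delta>>0. \<forall>h. 0 < h \<and> h < \<delta> \<longrightarrow> \<bar>(primitive (y + h) - primitive y) / h - \<phi> y\<bar> < e"
    if "y \<notin> N" "0 < e" for y e
  proof -
    have "norm (integral (cbox y (y + h *\<^sub>R One)) \<phi> /\<^sub>R h ^ DIM(real) - \<phi> y)
        = \<bar>(primitive (y + h) - primitive y) / h - \<phi> y\<bar>" if "0 < h" for h
      using that by (simp add: primitive_diff divide_inverse_commute)
    then show ?thesis using N(2)[OF that] by metis
  qed
  have main: "\<phi> (x - t * p u) = u" if u: "a < u" "u \<le> b" and notN: "x - t * p u \<notin> N" for u
  proof (rule ccontr)
    assume "\<phi> (x - t * p u) \<noteq> u"
    \<comment> \<open>The halving makes an error of \<open>e\<close> on each side contradictory, and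
      \<open>e < u - a\<close> keeps the comparison state \<open>w\<close> above
      \<open>a\<close>.\<close>
    define e where "e = min \<bar>\<phi> (x - t * p u) - u\<bar> (u - a) / 2"
    have e: "0 < e" "2 * e \<le> \<bar>\<phi> (x - t * p u) - u\<bar>" "e < u - a"
      using \<open>\<phi> (x - t * p u) \<noteq> u\<close> u(1) by (auto simp: e_def min_def)
    obtain \<delta> where \<delta>: "\<delta> > 0" "\<And>h. 0 < h \<Longrightarrow> h < \<delta> \<Longrightarrow>
        \<bar>(primitive (x - t * p u + h) - primitive (x - t * p u)) / h - \<phi> (x - t * p u)\<bar> < e"
      using N'[OF notN e(1)] by metis
    \<comment> \<open>So small that moving the foot to the right by \<open>h\<close> lowers the
      state from \<open>u\<close> to some \<open>w \<ge> u - e\<close>.\<close>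
    define h where "h = min \<delta> (t * (p u - p (u - e))) / 2"
    have h: "0 < h" "h < \<delta>" "h < t * (p u - p (u - e))"
      using \<delta>(1) e(1) assms(1) by (auto simp: h_def min_def)
    have "p (u - e) \<le> p u - h / t" "p u - h / t \<le> p u"
      using h assms(1) by (auto simp: field_simps)
    then obtain w where w: "p w = p u - h / t" "u - e \<le> w" "w \<le> u"
      by (rule p_intermediate)
    have th: "t * (p u - p w) = h" using w(1) assms(1) by simp
    then have "w < u" using w(3) h(1) by (cases "w = u") auto
    have step: "x - t * p w = x - t * p u + h" using th by (simp add: algebra_simps)
    have "t * (w * (p u - p w)) \<le> t * (G u - G w)" "t * (G u - G w) \<le> t * (u * (p u - p w))"
      using G_bounds[OF \<open>w < u\<close>] assms(1) by (auto intro!: mult_left_mono less_imp_le)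
    then have "w * h \<le> t * (G u - G w)" "t * (G u - G w) \<le> u * h"
      by (simp_all add: mult.left_commute flip: th)
    moreover have "primitive (x - t * p u + h) - primitive (x - t * p u) = t * (G u - G w)"
      using G_diff[of u w] u w e(3) unfolding step by simp
    ultimately have "w \<le> (primitive (x - t * p u + h) - primitive (x - t * p u)) / h"
      "(primitive (x - t * p u + h) - primitive (x - t * p u)) / h \<le> u"
      using h(1) by (simp_all add: pos_le_divide_eq pos_divide_le_eq)
    then have "\<bar>(primitive (x - t * p u + h) - primitive (x - t * p u)) / h - u\<bar> \<le> e"
      using w(2) by (simp add: abs_le_iff)
    then show False using \<delta>(2)[OF h(1,2)] e(2) by linarith
  qed
  show ?thesis
  proof (rule AE_I')
    \<comment> \<open>The foot of \<open>a\<close> is discarded too: to its right lie the feet of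
      states below \<open>a\<close>, about which nothing is known.\<close>
    show "insert (x - t * p a) N \<in> null_sets lebesgue"
      using N(1) by (simp add: negligible_iff_null_sets[symmetric] negligible_insert)
    show "{y \<in> space lebesgue. \<not> (y \<in> {x - t * p b..x - t * p a} \<longrightarrow> \<phi> y = inv p ((x - y) / t))}
      \<subseteq> insert (x - t * p a) N" (is "?bad \<subseteq> _")
    proof (intro subsetI, rule ccontr)
      fix y assume "y \<in> ?bad" "y \<notin> insert (x - t * p a) N"
      then have y: "x - t * p b \<le> y" "y \<le> x - t * p a" "\<phi> y \<noteq> inv p ((x - y) / t)"
        "y \<noteq> x - t * p a" "y \<notin> N" by auto
      then have "p a \<le> (x - y) / t" "(x - y) / t \<le> p b" using assms(1) by (auto simp: field_simps)
      then obtain u where u: "p u = (x - y) / t" "a \<le> u" "u \<le> b" by (rule p_intermediate)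
      then have yu: "y = x - t * p u" using assms(1) by simp
      then have "a \<noteq> u" using y(4) by auto
      then have "\<phi> y = u" using main[of u] u y(5) unfolding yu by simp
      moreover have "inv p ((x - y) / t) = u" using u(1) by (metis injI inv_f_f p_eq_iff)
      ultimately show False using y(3) by simp
    qed
  qed
qed

end

theorem theorem5p3:
  fixes f \<phi> :: "real \<Rightarrow> real" and x\<^sub>0 t\<^sub>0 :: real
  assumes "C2 f"
    and "\<And>s. deriv (deriv f) s \<ge> 0"
    and "{s. deriv (deriv f) s = 0} \<in> null_sets lebesgue"
    and "L_infinity \<phi>"
    and "t\<^sub>0 > 0"
  shows
    "(\<forall>(x, t) \<in> Delta f x\<^sub>0 t\<^sub>0 (frontier (maximizers f \<phi> x\<^sub>0 t\<^sub>0)).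
        trace_left f \<phi> x t = trace_right f \<phi> x t \<and>
        trace_left f \<phi> x t \<in> frontier (maximizers f \<phi> x\<^sub>0 t\<^sub>0) \<and>
        trace_right f \<phi> x t \<in> frontier (maximizers f \<phi> x\<^sub>0 t\<^sub>0))
     \<and>
     (\<forall>a b. {a<..<b} \<in> components (interior (maximizers f \<phi> x\<^sub>0 t\<^sub>0)) \<longrightarrow>
        (\<forall>(x, t) \<in> Delta f x\<^sub>0 t\<^sub>0 {a<..<b}.
           entropy_sol f \<phi> x t = inv (deriv f) ((x - x\<^sub>0) / (t - t\<^sub>0)) \<and>
           inv (deriv f) ((x - x\<^sub>0) / (t - t\<^sub>0)) \<in> {a<..<b}) \<and>
        (AE x in lebesgue. x \<in> {x\<^sub>0 - t\<^sub>0 * deriv f b .. x\<^sub>0 - t\<^sub>0 * deriv f a} \<longrightarrow>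
           \<phi> x = inv (deriv f) ((x\<^sub>0 - x) / t\<^sub>0)))
     \<and>
     (\<forall>c d. {c<..<d} \<in> components (state_interval f \<phi> x\<^sub>0 t\<^sub>0 - maximizers f \<phi> x\<^sub>0 t\<^sub>0) \<longrightarrow>
        (\<forall>(x\<^sub>1, t\<^sub>1) \<in> Delta f x\<^sub>0 t\<^sub>0 {c<..<d}.
           forward_char f \<phi> x\<^sub>1 t\<^sub>1 t\<^sub>0 = x\<^sub>0 \<and>
           (\<exists>tl. t\<^sub>1 \<le> tl \<and> tl < t\<^sub>0 \<and>
              (\<forall>t \<in> {tl<..t\<^sub>0}.
                 trace_right f \<phi> (forward_char f \<phi> x\<^sub>1 t\<^sub>1 t) t
                 < trace_left f \<phi> (forward_char f \<phi> x\<^sub>1 t\<^sub>1 t) t))) \<and>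
        (\<forall>(x\<^sub>1, t\<^sub>1) \<in> Delta f x\<^sub>0 t\<^sub>0 {c<..<d}. \<forall>(x\<^sub>2, t\<^sub>2) \<in> Delta f x\<^sub>0 t\<^sub>0 {c<..<d}.
           (x\<^sub>1, t\<^sub>1) \<noteq> (x\<^sub>2, t\<^sub>2) \<longrightarrow>
           (\<exists>tb. max t\<^sub>1 t\<^sub>2 < tb \<and> tb < t\<^sub>0 \<and>
              (\<forall>t \<in> {tb..t\<^sub>0}. forward_char f \<phi> x\<^sub>1 t\<^sub>1 t = forward_char f \<phi> x\<^sub>2 t\<^sub>2 t))) \<and>
        path_connected (discontinuities f \<phi> (Delta f x\<^sub>0 t\<^sub>0 {c<..<d})))
     \<and>
     (\<forall>(x\<^sub>1, t\<^sub>1) \<in> Delta f x\<^sub>0 t\<^sub>0 {..<trace_right f \<phi> x\<^sub>0 t\<^sub>0}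
                   \<union> Delta f x\<^sub>0 t\<^sub>0 {trace_left f \<phi> x\<^sub>0 t\<^sub>0<..}.
        forward_char f \<phi> x\<^sub>1 t\<^sub>1 t\<^sub>0 \<noteq> x\<^sub>0)"
proof -
  obtain C where "\<phi> \<in> borel_measurable lebesgue" "AE x in lebesgue. \<bar>\<phi> x\<bar> \<le> C"
    using assms(4) by (auto simp: L_infinity_def)
  then interpret convex_cauchy_problem f \<phi> C
    using assms(1-3) by unfold_locales
  let ?U = "U x\<^sub>0 t\<^sub>0"
  have char: "U x t = {u}" if "u \<in> ?U" "x = x\<^sub>0 - (t\<^sub>0 - t) * p u" "0 < t" "t < t\<^sub>0" for x t u
    using that maximizers_on_characteristic by blast
  have inv_p: "inv p (p u) = u" for u
    by (metis injI inv_f_f p_eq_iff)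
  have I: "state_interval f \<phi> x\<^sub>0 t\<^sub>0 = {umin x\<^sub>0 t\<^sub>0..umax x\<^sub>0 t\<^sub>0}"
    using assms(5) by (simp add: state_interval_def trace_left_eq trace_right_eq)
  have i: "trace_left f \<phi> x t = trace_right f \<phi> x t \<and> trace_left f \<phi> x t \<in> frontier ?U \<and>
      trace_right f \<phi> x t \<in> frontier ?U"
    if xt: "(x, t) \<in> Delta f x\<^sub>0 t\<^sub>0 (frontier ?U)" for x t
  proof -
    obtain u where u: "u \<in> frontier ?U" "x = x\<^sub>0 - (t\<^sub>0 - t) * p u" "0 < t" "t < t\<^sub>0"
      using xt by (auto simp: Delta_iff)
    \<comment> \<open>The maximizer set is closed, so its frontier points are maximizers and their
      characteristics carry a single state.\<close>
    have "frontier ?U \<subseteq> ?U"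
      by (intro frontier_subset_closed compact_imp_closed compact_maximizers assms(5))
    then have "U x t = {u}" using u by (intro char) auto
    then show ?thesis using u by (simp add: trace_left_eq trace_right_eq)
  qed
  have ii: "(\<forall>(x, t) \<in> Delta f x\<^sub>0 t\<^sub>0 {a<..<b}.
           entropy_sol f \<phi> x t = inv p ((x - x\<^sub>0) / (t - t\<^sub>0)) \<and>
           inv p ((x - x\<^sub>0) / (t - t\<^sub>0)) \<in> {a<..<b}) \<and>
        (AE x in lebesgue. x \<in> {x\<^sub>0 - t\<^sub>0 * p b .. x\<^sub>0 - t\<^sub>0 * p a} \<longrightarrow>
           \<phi> x = inv p ((x\<^sub>0 - x) / t\<^sub>0))"
    if ab: "{a<..<b} \<in> components (interior ?U)" for a b
  proof (intro conjI ballI, clarify)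
    have sub: "{a<..<b} \<subseteq> ?U" and "{a<..<b} \<noteq> {}"
      using ab in_components_subset in_components_nonempty interior_subset by blast+
    then have "a < b" by simp
    then show "AE x in lebesgue. x \<in> {x\<^sub>0 - t\<^sub>0 * p b .. x\<^sub>0 - t\<^sub>0 * p a} \<longrightarrow>
           \<phi> x = inv p ((x\<^sub>0 - x) / t\<^sub>0)"
      using datum_on_maximizing_interval assms(5) sub by blast
    fix x t assume "(x, t) \<in> Delta f x\<^sub>0 t\<^sub>0 {a<..<b}"
    then obtain u where u: "u \<in> {a<..<b}" "x = x\<^sub>0 - (t\<^sub>0 - t) * p u" "0 < t" "t < t\<^sub>0"
      by (auto simp: Delta_iff)
    then have "U x t = {u}" using sub by (intro char) auto
    moreover have "(x - x\<^sub>0) / (t - t\<^sub>0) = p u" using u by (simp add: field_simps)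
    ultimately show "entropy_sol f \<phi> x t = inv p ((x - x\<^sub>0) / (t - t\<^sub>0)) \<and>
           inv p ((x - x\<^sub>0) / (t - t\<^sub>0)) \<in> {a<..<b}"
      using u(1) by (simp add: entropy_sol_def inv_p)
  qed
  have iii: "(\<forall>(x\<^sub>1, t\<^sub>1) \<in> Delta f x\<^sub>0 t\<^sub>0 {c<..<d}.
           fwd x\<^sub>1 t\<^sub>1 t\<^sub>0 = x\<^sub>0 \<and>
           (\<exists>tl. t\<^sub>1 \<le> tl \<and> tl < t\<^sub>0 \<and>
              (\<forall>t \<in> {tl<..t\<^sub>0}. trace_right f \<phi> (fwd x\<^sub>1 t\<^sub>1 t) t < trace_left f \<phi> (fwd x\<^sub>1 t\<^sub>1 t) t))) \<and>
        (\<forall>(x\<^sub>1, t\<^sub>1) \<in> Delta f x\<^sub>0 t\<^sub>0 {c<..<d}. \<forall>(x\<^sub>2, t\<^sub>2) \<in> Delta f x\<^sub>0 t\<^sub>0 {c<..<d}.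
           (x\<^sub>1, t\<^sub>1) \<noteq> (x\<^sub>2, t\<^sub>2) \<longrightarrow>
           (\<exists>tb. max t\<^sub>1 t\<^sub>2 < tb \<and> tb < t\<^sub>0 \<and> (\<forall>t \<in> {tb..t\<^sub>0}. fwd x\<^sub>1 t\<^sub>1 t = fwd x\<^sub>2 t\<^sub>2 t))) \<and>
        path_connected (discontinuities f \<phi> (Delta f x\<^sub>0 t\<^sub>0 {c<..<d}))"
    if cd: "{c<..<d} \<in> components (state_interval f \<phi> x\<^sub>0 t\<^sub>0 - ?U)" for c d
  proof -
    \<comment> \<open>The state interval ends at the extreme maximizers, which makes the edges of
      the gap maximizers.\<close>
    have "c \<in> ?U" "d \<in> ?U" "{c<..<d} \<inter> ?U = {}"
      using component_Ioo_endpoints[OF cd[unfolded I] umin_in umax_in] assms(5) by blast+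
    note gap = assms(5) this
    have 1: "fwd x\<^sub>1 t\<^sub>1 t\<^sub>0 = x\<^sub>0 \<and>
           (\<exists>tl. t\<^sub>1 \<le> tl \<and> tl < t\<^sub>0 \<and>
              (\<forall>t \<in> {tl<..t\<^sub>0}. trace_right f \<phi> (fwd x\<^sub>1 t\<^sub>1 t) t < trace_left f \<phi> (fwd x\<^sub>1 t\<^sub>1 t) t))"
      if R: "(x\<^sub>1, t\<^sub>1) \<in> Delta f x\<^sub>0 t\<^sub>0 {c<..<d}" for x\<^sub>1 t\<^sub>1
    proof -
      have "0 < t\<^sub>1" using R by (auto simp: Delta_iff)
      obtain tl where tl: "t\<^sub>1 \<le> tl" "tl < t\<^sub>0"
        "\<And>t. tl < t \<Longrightarrow> t \<le> t\<^sub>0 \<Longrightarrow> umin (fwd x\<^sub>1 t\<^sub>1 t) t < umax (fwd x\<^sub>1 t\<^sub>1 t) t"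
        using gap_fwd_discontinuous[OF gap R] by blast
      then show ?thesis
        using gap_fwd_target[OF gap R] \<open>0 < t\<^sub>1\<close> by (auto simp: trace_left_eq trace_right_eq)
    qed
    have 2: "\<exists>tb. max t\<^sub>1 t\<^sub>2 < tb \<and> tb < t\<^sub>0 \<and> (\<forall>t \<in> {tb..t\<^sub>0}. fwd x\<^sub>1 t\<^sub>1 t = fwd x\<^sub>2 t\<^sub>2 t)"
      if "(x\<^sub>1, t\<^sub>1) \<in> Delta f x\<^sub>0 t\<^sub>0 {c<..<d}" "(x\<^sub>2, t\<^sub>2) \<in> Delta f x\<^sub>0 t\<^sub>0 {c<..<d}" for x\<^sub>1 t\<^sub>1 x\<^sub>2 t\<^sub>2
      using gap_fwd_merge[OF gap that] by (metis atLeastAtMost_iff)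
    show ?thesis
      using 1 2 path_connected_discontinuities_gap[OF gap] by blast
  qed
  have iv: "fwd x\<^sub>1 t\<^sub>1 t\<^sub>0 \<noteq> x\<^sub>0"
    if xt: "(x\<^sub>1, t\<^sub>1) \<in> Delta f x\<^sub>0 t\<^sub>0 {..<trace_right f \<phi> x\<^sub>0 t\<^sub>0}
      \<union> Delta f x\<^sub>0 t\<^sub>0 {trace_left f \<phi> x\<^sub>0 t\<^sub>0<..}" for x\<^sub>1 t\<^sub>1
  proof -
    \<comment> \<open>States beyond the extreme maximizers give points outside the triangle, and
      only points inside it are carried to \<open>x\<^sub>0\<close> at time
      \<open>t\<^sub>0\<close>.\<close>
    obtain u where u: "x\<^sub>1 = x\<^sub>0 - (t\<^sub>0 - t\<^sub>1) * p u" "0 < t\<^sub>1" "t\<^sub>1 < t\<^sub>0"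
      "u < umin x\<^sub>0 t\<^sub>0 \<or> umax x\<^sub>0 t\<^sub>0 < u"
      using xt assms(5) by (auto simp: Delta_iff trace_left_eq trace_right_eq)
    then show ?thesis by (auto simp: fwd_eq_iff char_triangle_iff not_le)
  qed
  show ?thesis
    by (rule conjI[OF _ conjI[OF _ conjI]], use i in blast, intro allI impI, erule ii,
      intro allI impI, erule iii, use iv in blast)
qed

end
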